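(* Let $\mathcal{K}\subseteq\mathcal{L}$ be MU-categories. Then $\mathcal{K}\subseteq\mathcal{L}$ is $\sigma$-consistent if and only if $\sigma^\forall\mathcal{K}=\sigma^\exists\mathcal{K}$, and in that case we have: (i) $\sigma\mathcal{K}\cap\mathcal{L}(\mathcal{K},\mathcal{K})=\overline{\mathcal{K}}$, i.e. $\mathcal{K}$ is locally dense in $\sigma\mathcal{K}$; (ii) $\sigma\mathcal{K}\cap\mathcal{L}(\sigma\mathcal{K},\mathcal{K})=\overline{\mathrm{cl}^{\mathrm{lim}}(\mathcal{K})}=\mathcal{A}_0\cap\mathcal{L}(\sigma\mathcal{K},\mathcal{K})$; (iii) $\sigma\mathcal{K}=\sigma^\forall\mathcal{K}=\sigma^\exists\mathcal{K}=\mathrm{cl}^{\mathrm{refl}}(\mathcal{A}_0)=\mathcal{A}_1$. In particular, all these descriptions of $\sigma\mathcal{K}$ agree, and the iterative construction of $\sigma\mathcal{K}$ stops after the first step (at $\mathcal{A}_1$).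
   Context: An $\infty$-metric is a metric allowed to take the value $\infty$. An MU-category is a category with an $\infty$-metric $d$ on every hom-set such that (1) $d(g\circ f,h\circ f)\le d(g,h)$ for all maps $f$ and all compatible $g,h$, and (2) for every map $f$ and $\varepsilon>0$ there is $\delta>0$ such that for every object $W$ and all $g,h\colon W\to\mathrm{dom}(f)$, $d(g,h)<\delta$ implies $d(f\circ g,f\circ h)<\varepsilon$. We write $f\approx_\varepsilon g$ for $d(f,g)<\varepsilon$. A category is identified with its class of morphisms; $\mathcal{K}\subseteq\mathcal{L}$ is a (not necessarily full) subcategory with restricted metrics. A $\mathcal{K}$-sequence $\langle X_*,f_*\rangle$ consists of $\mathcal{K}$-maps $f_n\colon X_{n+1}\to X_n$, $n\in\omega$; $f_{n,n'}=f_n\circ\cdots\circ f_{n'-1}\colon X_{n'}\to X_n$ for $n\le n'$. An $\mathcal{L}$-limit $\langle X_\infty,f_{*,\infty}\rangle$ is a category-theoretic inverse limit in $\mathcal{L}$ with cone maps $f_{n,\infty}\colon X_\infty\to X_n$. Closures of a family of maps $\mathcal{F}\subseteq\mathcal{L}$: - $\mathrm{cl}^{\mathrm{cat}}(\mathcal{F})$ is the subcategory of $\mathcal{L}$ generated by $\mathcal{F}$; - $\overline{\mathcal{F}}$ is the local closure: $\overline{\mathcal{F}}\cap\mathcal{L}(X,Y)$ is the closure of $\mathcal{F}\cap\mathcal{L}(X,Y)$ in $\mathcal{L}(X,Y)$ for all $\mathcal{L}$-objects $X,Y$; - $\mathrm{cl}^{\mathrm{lim}}(\mathcal{F})$ consists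 of $\mathcal{F}$ together with all maps $f_{n,\infty}$, $n\in\omega$, where $f_{*,\infty}$ is an $\mathcal{L}$-limit cone of a $\mathcal{K}$-sequence $f_*$ with $f_{n',n''}\in\mathcal{K}\cap\mathcal{F}$ for all $n'\le n''$; - $\mathrm{cl}^{\mathrm{refl}}(\mathcal{F})$ consists of $\mathcal{F}$ together with all $\mathcal{L}$-maps $h$ such that there is a $\mathcal{K}$-sequence $f_*$ with all $f_{n',n''}\in\mathcal{K}\cap\mathcal{F}$ and an $\mathcal{L}$-limit cone $f_{*,\infty}$ of $f_*$ with all $f_{n,\infty}\in\mathcal{F}$ and $f_{n,\infty}\circ h\in\mathcal{F}$ for every $n\in\omega$. Put $\mathcal{A}_0=\overline{\mathrm{cl}^{\mathrm{cat}}(\mathrm{cl}^{\mathrm{lim}}(\mathcal{K}))}$, $\mathcal{A}_{\alpha+1}=\overline{\mathrm{cl}^{\mathrm{cat}}(\mathrm{cl}^{\mathrm{refl}}(\mathcal{A}_\alpha))}$ for every ordinal $\alpha$, and $\mathcal{A}_\alpha=\bigcup_{\beta<\alpha}\mathcal{A}_\beta$ for limit $\alpha$. The $\sigma$-closure is $\sigma\mathcal{K}=\mathcal{A}_{\omega_1}$; it is the smallest subcategory of $\mathcal{L}$ containing $\mathcal{K}$ and closed under all four closures. The $\sigma\mathcal{K}$-objects are exactly the $\mathcal{L}$-limit objects of $\mathcal{K}$-sequences. $\mathcal{L}(\mathcal{K},\mathcal{K})$ denotes the family of all $\mathcal{L}$-maps between $\mathcal{K}$-objects and $\mathcal{L}(\sigma\mathcal{K},\mathcal{K})$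 the family of all $\mathcal{L}$-maps from $\sigma\mathcal{K}$-objects to $\mathcal{K}$-objects. $\mathcal{K}$ is locally dense in $\sigma\mathcal{K}$ if $\mathcal{K}(X,Y)$ is dense in $\sigma\mathcal{K}(X,Y)$ for all $\mathcal{K}$-objects $X,Y$. Pre-transformations. For $\mathcal{K}$-sequences $\langle X_*,f_*\rangle$, $\langle Y_*,g_*\rangle$, a pre-transformation $\varphi_*\colon f_*\to g_*$ is a family $\langle\varphi_n\colon X_{\varphi(n)}\to Y_n\rangle_{n\in\omega}$ of $\mathcal{K}$-maps, where $\langle\varphi(n)\rangle_{n\in\omega}$ is an increasing sequence in $\omega$. Given $\mathcal{L}$-limits $\langle X_\infty,f_{*,\infty}\rangle$, $\langle Y_\infty,g_{*,\infty}\rangle$, an $\mathcal{L}$-map $h\colon X_\infty\to Y_\infty$ is the limit of $\varphi_*$ if for every $n\in\omega$ and $\varepsilon>0$ there is $n_0\ge n$ such that for every $n'\ge n_0$ we have $g_{n,n'}\circ\varphi_{n'}\circ f_{\varphi(n'),\infty}\approx_\varepsilon g_{n,\infty}\circ h$. $\sigma^\exists\mathcal{K}$ (resp. $\sigma^\forall\mathcal{K}$) is the family of all $\mathcal{L}$-maps $h\colon X\to Y$ between $\sigma\mathcal{K}$-objects such that for some (resp. all) $\mathcal{K}$-sequences $f_*$ and $g_*$ with $\mathcal{L}$-limits $\langle X,f_{*,\infty}\rangle$ and $\langle Y,g_{*,\infty}\rangle$ there is a pre-transformation $\varphi_*\colon f_*\to g_*$ with limit $h$. $\sigma$-consistency.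 $\mathcal{K}\subseteq\mathcal{L}$ is $\sigma$-consistent if for every pair of $\mathcal{K}$-sequences $\langle X_*,f_*\rangle$, $\langle Y_*,g_*\rangle$ with $\mathcal{L}$-limits $\langle X_\infty,f_{*,\infty}\rangle$, $\langle Y_\infty,g_{*,\infty}\rangle$ such that $X_\infty=Y_\infty$, and every $n\in\omega$ and $\varepsilon>0$, there is $m\in\omega$ and a $\mathcal{K}$-map $h\colon X_m\to Y_n$ such that $h\circ f_{m,\infty}\approx_\varepsilon g_{n,\infty}$. *)

theory Defs
  imports "HOL-Library.Extended_Nonnegative_Real"
begin

record ('o, 'a) mucat =
  Obj :: "'o set"
  Arr :: "'a set"
  Dom :: "'a \<Rightarrow> 'o"
  Cod :: "'a \<Rightarrow> 'o"
  Ident :: "'o \<Rightarrow> 'a"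
  Comp :: "'a \<Rightarrow> 'a \<Rightarrow> 'a"  (infixl \<open>\<cdot>\<index>\<close> 70)
  Dist :: "'a \<Rightarrow> 'a \<Rightarrow> ennreal"

definition hom :: "('o, 'a) mucat \<Rightarrow> 'o \<Rightarrow> 'o \<Rightarrow> 'a set" where
  "hom L X Y = {f \<in> Arr L. Dom L f = X \<and> Cod L f = Y}"

definition approx :: "('o, 'a) mucat \<Rightarrow> real \<Rightarrow> 'a \<Rightarrow> 'a \<Rightarrow> bool" where
  "approx L \<epsilon> f g \<longleftrightarrow> Dist L f g < ennreal \<epsilon>"

locale MU_category =
  fixes L :: "('o, 'a) mucat" (structure)
  assumes dom_obj: "f \<in> Arr L \<Longrightarrow> Dom L f \<in> Obj L"
    and cod_obj: "f \<in> Arr L \<Longrightarrow> Cod L f \<in> Obj L"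
    and ident_hom: "X \<in> Obj L \<Longrightarrow> Ident L X \<in> hom L X X"
    and comp_hom: "\<lbrakk>f \<in> hom L X Y; g \<in> hom L Y Z\<rbrakk> \<Longrightarrow> g \<cdot> f \<in> hom L X Z"
    and comp_ident_right: "f \<in> Arr L \<Longrightarrow> f \<cdot> Ident L (Dom L f) = f"
    and comp_ident_left: "f \<in> Arr L \<Longrightarrow> Ident L (Cod L f) \<cdot> f = f"
    and comp_assoc:
      "\<lbrakk>f \<in> hom L W X; g \<in> hom L X Y; h \<in> hom L Y Z\<rbrakk> \<Longrightarrow> h \<cdot> (g \<cdot> f) = (h \<cdot> g) \<cdot> f"
    and dist_eq_0: "\<lbrakk>f \<in> hom L X Y; g \<in> hom L X Y\<rbrakk> \<Longrightarrow> Dist L f g = 0 \<longleftrightarrow> f = g"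
    and dist_sym: "\<lbrakk>f \<in> hom L X Y; g \<in> hom L X Y\<rbrakk> \<Longrightarrow> Dist L f g = Dist L g f"
    and dist_triangle:
      "\<lbrakk>f \<in> hom L X Y; g \<in> hom L X Y; h \<in> hom L X Y\<rbrakk> \<Longrightarrow>
        Dist L f h \<le> Dist L f g + Dist L g h"
    and dist_precomp:
      "\<lbrakk>f \<in> hom L X Y; g \<in> hom L Y Z; h \<in> hom L Y Z\<rbrakk> \<Longrightarrow>
        Dist L (g \<cdot> f) (h \<cdot> f) \<le> Dist L g h"
    and postcomp_uniform:
      "\<lbrakk>f \<in> Arr L; (\<epsilon>::real) > 0\<rbrakk> \<Longrightarrow>
        \<exists>\<delta>>0. \<forall>W\<in>Obj L. \<forall>g\<in>hom L W (Dom L f). \<forall>h\<in>hom L W (Dom L f).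
          approx L \<delta> g h \<longrightarrow> approx L \<epsilon> (f \<cdot> g) (f \<cdot> h)"

text \<open>A subcategory is given by its class of morphisms, its objects being those whose identity
  belongs to it; see \<open>subcat_MU_category\<close> below.\<close>

definition subcategory :: "('o, 'a) mucat \<Rightarrow> 'a set \<Rightarrow> bool" where
  "subcategory L C \<longleftrightarrow> C \<subseteq> Arr L
    \<and> (\<forall>f\<in>C. Ident L (Dom L f) \<in> C \<and> Ident L (Cod L f) \<in> C)
    \<and> (\<forall>f\<in>C. \<forall>g\<in>C. Cod L f = Dom L g \<longrightarrow> g \<cdot>\<^bsub>L\<^esub> f \<in> C)"

definition objs :: "('o, 'a) mucat \<Rightarrow> 'a set \<Rightarrow> 'o set" where
  "objs L C = {X \<in> Obj L. Ident L X \<in> C}"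

lemma (in MU_category) subcat_MU_category:
  assumes K: "subcategory L K"
  shows "MU_category (L\<lparr>Obj := objs L K, Arr := K\<rparr>)"
proof -
  have sub: "f \<in> K \<Longrightarrow> f \<in> Arr L" for f
    using K by (auto simp: subcategory_def)
  have objs_sub: "objs L K \<subseteq> Obj L"
    by (auto simp: objs_def)
  let ?M = "L\<lparr>Obj := objs L K, Arr := K\<rparr>"
  have hom_iff: "f \<in> hom ?M X Y \<longleftrightarrow> f \<in> hom L X Y \<and> f \<in> K" for f X Y
    by (auto simp: hom_def sub)
  show ?thesis
  proof
    fix f and \<epsilon> :: real
    assume "f \<in> Arr ?M" and "0 < \<epsilon>"
    then obtain \<delta> where "\<delta> > 0" and "\<forall>W\<in>Obj L. \<forall>g\<in>hom L W (Dom L f). \<forall>h\<in>hom L W (Dom L f).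
          approx L \<delta> g h \<longrightarrow> approx L \<epsilon> (f \<cdot> g) (f \<cdot> h)"
      using postcomp_uniform[of f \<epsilon>] sub by auto
    then show "\<exists>\<delta>>0. \<forall>W\<in>Obj ?M.
        \<forall>g\<in>hom ?M W (Dom ?M f).
        \<forall>h\<in>hom ?M W (Dom ?M f).
          approx ?M \<delta> g h \<longrightarrow>
          approx ?M \<epsilon>
            (f \<cdot>\<^bsub>?M\<^esub> g) (f \<cdot>\<^bsub>?M\<^esub> h)"
      using objs_sub by (intro exI[of _ \<delta>]) (auto simp: approx_def hom_iff)
  next
    fix f g X Y Z
    assume "f \<in> hom ?M X Y" "g \<in> hom ?M Y Z"
    then show "g \<cdot>\<^bsub>?M\<^esub> f \<in> hom ?M X Z"
      using K comp_hom[of f X Y g Z] unfolding hom_iff by (auto simp: subcategory_def hom_def)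
  next
    fix f X Y g h
    assume "f \<in> hom ?M X Y" "g \<in> hom ?M X Y"
      "h \<in> hom ?M X Y"
    then show "Dist ?M f h
        \<le> Dist ?M f g + Dist ?M g h"
      using dist_triangle[of f X Y g h] by (simp add: hom_iff)
  next
    fix f X Y g Z h
    assume "f \<in> hom ?M X Y" "g \<in> hom ?M Y Z"
      "h \<in> hom ?M Y Z"
    then show "Dist ?M (g \<cdot>\<^bsub>?M\<^esub> f)
        (h \<cdot>\<^bsub>?M\<^esub> f) \<le> Dist ?M g h"
      using dist_precomp[of f X Y g Z h] by (simp add: hom_iff)
  next
    fix f X Y g
    assume "f \<in> hom ?M X Y" "g \<in> hom ?M X Y"
    then show "Dist ?M f g = Dist ?M g f"
      and "(Dist ?M f g = 0) = (f = g)"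
      using dist_sym[of f X Y g] dist_eq_0[of f X Y g] by (simp_all add: hom_iff)
  next
    fix f W X g Y h Z
    assume "f \<in> hom ?M W X" "g \<in> hom ?M X Y"
      "h \<in> hom ?M Y Z"
    then show "h \<cdot>\<^bsub>?M\<^esub> (g \<cdot>\<^bsub>?M\<^esub> f)
      = h \<cdot>\<^bsub>?M\<^esub> g \<cdot>\<^bsub>?M\<^esub> f"
      using comp_assoc[of f W X g Y h Z] by (simp add: hom_iff)
  next
    fix X assume "X \<in> Obj ?M"
    then show "Ident ?M X \<in> hom ?M X X"
      using ident_hom[of X] unfolding hom_iff by (simp add: objs_def)
  next
    fix f assume f: "f \<in> Arr ?M"
    then show "Dom ?M f \<in> Obj ?M"
      and "Cod ?M f \<in> Obj ?M"
      using K dom_obj[of f] cod_obj[of f] sub[of f] by (simp_all add: subcategory_def objs_def)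
    show "f \<cdot>\<^bsub>?M\<^esub> Ident ?M (Dom ?M f) = f"
      and "Ident ?M (Cod ?M f) \<cdot>\<^bsub>?M\<^esub> f = f"
      using f sub[of f] comp_ident_left[of f] comp_ident_right[of f] by simp_all
  qed
qed


definition K_sequence ::
  "('o, 'a) mucat \<Rightarrow> 'a set \<Rightarrow> (nat \<Rightarrow> 'o) \<Rightarrow> (nat \<Rightarrow> 'a) \<Rightarrow> bool" where
  "K_sequence L K X f \<longleftrightarrow> (\<forall>n. f n \<in> K \<and> f n \<in> hom L (X (Suc n)) (X n))"

text \<open>\<open>bond L X f n n'\<close> is \<open>f n \<cdot> \<dots> \<cdot> f (n' - 1) : X n' \<rightarrow> X n\<close>; only used for \<open>n \<le> n'\<close>.\<close>

primrec bond ::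
  "('o, 'a) mucat \<Rightarrow> (nat \<Rightarrow> 'o) \<Rightarrow> (nat \<Rightarrow> 'a) \<Rightarrow> nat \<Rightarrow> nat \<Rightarrow> 'a" where
  "bond L X f n 0 = Ident L (X n)"
| "bond L X f n (Suc m) = (if n \<le> m then bond L X f n m \<cdot>\<^bsub>L\<^esub> f m else Ident L (X n))"

definition is_cone ::
  "('o, 'a) mucat \<Rightarrow> (nat \<Rightarrow> 'o) \<Rightarrow> (nat \<Rightarrow> 'a) \<Rightarrow> 'o \<Rightarrow> (nat \<Rightarrow> 'a) \<Rightarrow> bool" where
  "is_cone L X f W p \<longleftrightarrow>
    W \<in> Obj L \<and> (\<forall>n. p n \<in> hom L W (X n)) \<and> (\<forall>n. f n \<cdot>\<^bsub>L\<^esub> p (Suc n) = p n)"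

definition is_limit ::
  "('o, 'a) mucat \<Rightarrow> (nat \<Rightarrow> 'o) \<Rightarrow> (nat \<Rightarrow> 'a) \<Rightarrow> 'o \<Rightarrow> (nat \<Rightarrow> 'a) \<Rightarrow> bool" where
  "is_limit L X f Z p \<longleftrightarrow> is_cone L X f Z p \<and>
    (\<forall>W q. is_cone L X f W q \<longrightarrow> (\<exists>!h. h \<in> hom L W Z \<and> (\<forall>n. p n \<cdot>\<^bsub>L\<^esub> h = q n)))"


definition cl_cat :: "('o, 'a) mucat \<Rightarrow> 'a set \<Rightarrow> 'a set" where
  "cl_cat L F = \<Inter>{C. subcategory L C \<and> F \<subseteq> C}"

definition metric_closure :: "('o, 'a) mucat \<Rightarrow> 'a set \<Rightarrow> 'a set \<Rightarrow> 'a set" where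
  "metric_closure L H S = {h \<in> H. \<forall>\<epsilon>>0. \<exists>f\<in>S. approx L \<epsilon> f h}"

definition local_closure :: "('o, 'a) mucat \<Rightarrow> 'a set \<Rightarrow> 'a set" where
  "local_closure L F =
    (\<Union>X\<in>Obj L. \<Union>Y\<in>Obj L. metric_closure L (hom L X Y) (F \<inter> hom L X Y))"

definition locally_dense :: "('o, 'a) mucat \<Rightarrow> 'a set \<Rightarrow> 'a set \<Rightarrow> bool" where
  "locally_dense L K C \<longleftrightarrow> (\<forall>X\<in>objs L K. \<forall>Y\<in>objs L K.
    metric_closure L (C \<inter> hom L X Y) (K \<inter> hom L X Y) = C \<inter> hom L X Y)"

definition cl_lim :: "('o, 'a) mucat \<Rightarrow> 'a set \<Rightarrow> 'a set \<Rightarrow> 'a set" where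
  "cl_lim L K F = F \<union> {p n | p n. \<exists>X f Z.
      K_sequence L K X f \<and> is_limit L X f Z p \<and>
      (\<forall>i j. i \<le> j \<longrightarrow> bond L X f i j \<in> K \<inter> F)}"

definition cl_refl :: "('o, 'a) mucat \<Rightarrow> 'a set \<Rightarrow> 'a set \<Rightarrow> 'a set" where
  "cl_refl L K F = F \<union> {h \<in> Arr L. \<exists>X f Z p.
      K_sequence L K X f \<and> is_limit L X f Z p \<and>
      (\<forall>i j. i \<le> j \<longrightarrow> bond L X f i j \<in> K \<inter> F) \<and>
      Cod L h = Z \<and> (\<forall>n. p n \<in> F \<and> p n \<cdot>\<^bsub>L\<^esub> h \<in> F)}"

definition sigma_start :: "('o, 'a) mucat \<Rightarrow> 'a set \<Rightarrow> 'a set" where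
  "sigma_start L K = local_closure L (cl_cat L (cl_lim L K K))"

definition sigma_step :: "('o, 'a) mucat \<Rightarrow> 'a set \<Rightarrow> 'a set \<Rightarrow> 'a set" where
  "sigma_step L K F = local_closure L (cl_cat L (cl_refl L K F))"

text \<open>Ordinals are represented by the elements of well-orders: an element \<open>a\<close> of a well-order
  \<open>r\<close> stands for the order type of \<open>underS r a\<close>. Accordingly \<open>sigma_stage L K r a\<close> is the stage
  \<open>\<A>\<^sub>\<alpha>\<close> of the transfinite iteration, where \<open>\<alpha>\<close> is the order type of \<open>underS r a\<close>. The lemmas
  \<open>sigma_stage_zero\<close>, \<open>sigma_stage_succ\<close> and \<open>sigma_stage_limit\<close> are the recursion equations.\<close>

definition immediate_pred :: "'i rel \<Rightarrow> 'i \<Rightarrow> 'i \<Rightarrow> bool" where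
  "immediate_pred r b a \<longleftrightarrow> b \<in> underS r a \<and> (\<forall>c\<in>underS r a. (c, b) \<in> r)"

definition sigma_stage ::
  "('o, 'a) mucat \<Rightarrow> 'a set \<Rightarrow> 'i rel \<Rightarrow> 'i \<Rightarrow> 'a set" where
  "sigma_stage L K r = wo_rel.worec r (\<lambda>A a.
     if underS r a = {} then sigma_start L K
     else if \<exists>b. immediate_pred r b a
          then sigma_step L K (A (THE b. immediate_pred r b a))
     else (\<Union>b\<in>underS r a. A b))"

lemma immediate_pred_unique:
  assumes "Well_order r" "immediate_pred r b a" "immediate_pred r c a"
  shows "b = c"
  using assms wo_rel.ANTISYM[of r] unfolding immediate_pred_def wo_rel_def antisym_def by blast

lemma sigma_stage_unfold:
  fixes L :: "('o, 'a) mucat" and r :: "'i rel"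
  assumes "Well_order r"
  shows "sigma_stage L K r a =
    (if underS r a = {} then sigma_start L K
     else if \<exists>b. immediate_pred r b a
          then sigma_step L K (sigma_stage L K r (THE b. immediate_pred r b a))
     else (\<Union>b\<in>underS r a. sigma_stage L K r b))"
proof -
  have r: "wo_rel r" using assms by (simp add: wo_rel_def)
  let ?H = "\<lambda>(A :: 'i \<Rightarrow> 'a set) a. if underS r a = {} then sigma_start L K
     else if \<exists>b. immediate_pred r b a
          then sigma_step L K (A (THE b. immediate_pred r b a))
     else (\<Union>b\<in>underS r a. A b)"
  have "wo_rel.adm_wo r ?H"
    unfolding wo_rel.adm_wo_def[OF r]
  proof (intro allI impI)
    fix A B :: "'i \<Rightarrow> 'a set" and x
    assume *: "\<forall>y\<in>underS r x. A y = B y"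
    have "A (THE b. immediate_pred r b x) = B (THE b. immediate_pred r b x)"
      if "\<exists>b. immediate_pred r b x"
    proof -
      from that obtain b where b: "immediate_pred r b x" ..
      have "(THE b. immediate_pred r b x) = b"
        using b immediate_pred_unique[OF assms _ b] by (rule the_equality)
      then show ?thesis
        using * b by (simp add: immediate_pred_def)
    qed
    moreover have "(\<Union>b\<in>underS r x. A b) = (\<Union>b\<in>underS r x. B b)"
      using * by simp
    ultimately show "?H A x = ?H B x"
      by (cases "\<exists>b. immediate_pred r b x") simp_all
  qed
  from wo_rel.worec_fixpoint[OF r this] show ?thesis
    unfolding sigma_stage_def by (rule fun_cong)
qed

lemma sigma_stage_zero:
  "Well_order r \<Longrightarrow> underS r a = {} \<Longrightarrow> sigma_stage L K r a = sigma_start L K"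
  by (subst sigma_stage_unfold) auto

lemma sigma_stage_succ:
  assumes "Well_order r" "immediate_pred r b a"
  shows "sigma_stage L K r a = sigma_step L K (sigma_stage L K r b)"
proof -
  have "(THE b. immediate_pred r b a) = b"
    using assms(2) immediate_pred_unique[OF assms(1) _ assms(2)] by (rule the_equality)
  moreover have "underS r a \<noteq> {}"
    using assms by (auto simp: immediate_pred_def)
  ultimately show ?thesis
    using assms by (subst sigma_stage_unfold) auto
qed

lemma sigma_stage_limit:
  "Well_order r \<Longrightarrow> underS r a \<noteq> {} \<Longrightarrow> \<nexists>b. immediate_pred r b a \<Longrightarrow>
    sigma_stage L K r a = (\<Union>b\<in>underS r a. sigma_stage L K r b)"
  by (subst sigma_stage_unfold) auto

text \<open>The first uncountable ordinal, as the initial well-order of the successor of \<open>\<aleph>\<^sub>0\<close>. Its elements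
  are the countable ordinals, so the union below is the limit stage \<open>\<A>\<^bsub>\<omega>\<^sub>1\<^esub>\<close>.\<close>

definition omega1 :: "nat set rel" where
  "omega1 = cardSuc natLeq"

definition sigma_closure :: "('o, 'a) mucat \<Rightarrow> 'a set \<Rightarrow> 'a set" where
  "sigma_closure L K = (\<Union>a\<in>Field omega1. sigma_stage L K omega1 a)"

definition maps_between :: "('o, 'a) mucat \<Rightarrow> 'o set \<Rightarrow> 'o set \<Rightarrow> 'a set" where
  "maps_between L A B = {f \<in> Arr L. Dom L f \<in> A \<and> Cod L f \<in> B}"


text \<open>The index sequence \<open>s\<close> plays the role of \<open>\<langle>\<phi>(n)\<rangle>\<^sub>n\<close> and \<open>\<phi> n\<close> that of \<open>\<phi>\<^sub>n\<close>.
  Requiring only \<open>mono s\<close> would not change the limits of pre-transformations: composing \<open>\<phi> n\<close> with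
  bonding maps raises \<open>s n\<close> without affecting \<open>\<phi> n \<cdot> p (s n)\<close>.\<close>

definition pre_transformation ::
  "('o, 'a) mucat \<Rightarrow> 'a set \<Rightarrow> (nat \<Rightarrow> 'o) \<Rightarrow> (nat \<Rightarrow> 'o) \<Rightarrow>
    (nat \<Rightarrow> nat) \<Rightarrow> (nat \<Rightarrow> 'a) \<Rightarrow> bool" where
  "pre_transformation L K X Y s \<phi> \<longleftrightarrow>
    strict_mono s \<and> (\<forall>n. \<phi> n \<in> K \<and> \<phi> n \<in> hom L (X (s n)) (Y n))"

definition is_pretrans_limit ::
  "('o, 'a) mucat \<Rightarrow> (nat \<Rightarrow> 'a) \<Rightarrow> (nat \<Rightarrow> 'o) \<Rightarrow> (nat \<Rightarrow> 'a) \<Rightarrow> (nat \<Rightarrow> 'a) \<Rightarrow>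
    (nat \<Rightarrow> nat) \<Rightarrow> (nat \<Rightarrow> 'a) \<Rightarrow> 'a \<Rightarrow> bool" where
  "is_pretrans_limit L p Y g q s \<phi> h \<longleftrightarrow>
    (\<forall>n. \<forall>\<epsilon>>0. \<exists>n0\<ge>n. \<forall>n'\<ge>n0.
      approx L \<epsilon> (bond L Y g n n' \<cdot>\<^bsub>L\<^esub> \<phi> n' \<cdot>\<^bsub>L\<^esub> p (s n')) (q n \<cdot>\<^bsub>L\<^esub> h))"

definition sigma_exists :: "('o, 'a) mucat \<Rightarrow> 'a set \<Rightarrow> 'a set" where
  "sigma_exists L K =
    {h \<in> maps_between L (objs L (sigma_closure L K)) (objs L (sigma_closure L K)).
      \<exists>X f p Y g q.
        K_sequence L K X f \<and> is_limit L X f (Dom L h) p \<and>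
        K_sequence L K Y g \<and> is_limit L Y g (Cod L h) q \<and>
        (\<exists>s \<phi>. pre_transformation L K X Y s \<phi> \<and> is_pretrans_limit L p Y g q s \<phi> h)}"

definition sigma_forall :: "('o, 'a) mucat \<Rightarrow> 'a set \<Rightarrow> 'a set" where
  "sigma_forall L K =
    {h \<in> maps_between L (objs L (sigma_closure L K)) (objs L (sigma_closure L K)).
      \<forall>X f p Y g q.
        K_sequence L K X f \<and> is_limit L X f (Dom L h) p \<and>
        K_sequence L K Y g \<and> is_limit L Y g (Cod L h) q \<longrightarrow>
        (\<exists>s \<phi>. pre_transformation L K X Y s \<phi> \<and> is_pretrans_limit L p Y g q s \<phi> h)}"

definition sigma_consistent :: "('o, 'a) mucat \<Rightarrow> 'a set \<Rightarrow> bool" where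
  "sigma_consistent L K \<longleftrightarrow>
    (\<forall>X f Y g Z p q.
      K_sequence L K X f \<and> is_limit L X f Z p \<and>
      K_sequence L K Y g \<and> is_limit L Y g Z q \<longrightarrow>
      (\<forall>n. \<forall>\<epsilon>>0. \<exists>m. \<exists>h\<in>K. h \<in> hom L (X m) (Y n) \<and> approx L \<epsilon> (h \<cdot>\<^bsub>L\<^esub> p m) (q n)))"

end

theory Submission
  imports Defs
begin

text \<open>For a limit \<open>\<langle>Z, p\<rangle>\<close> of a \<open>\<K>\<close>-sequence \<open>X\<close> and a \<open>\<K>\<close>-object \<open>Y\<close>, let \<open>D(Z, Y)\<close> be the closure of the
  maps \<open>e \<cdot> p\<^sub>m\<close> with \<open>e : X\<^sub>m \<rightarrow> Y\<close> in \<open>\<K>\<close>. By uniform continuity of composition, \<open>h\<close> is a limit of a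
  pre-transformation into \<open>\<langle>Y, q\<rangle>\<close> iff every \<open>q\<^sub>n \<cdot> h\<close> lies in \<open>D\<close>. Consistency says exactly that
  \<open>D(Z, Y)\<close> does not depend on the sequence chosen for \<open>Z\<close>. The limits of pre-transformations
  then form a locally closed subcategory, closed under \<open>cl_refl\<close> and generated in one step, because
  \<open>D(Z, Y)\<close> is the part of the closure of \<open>cl_lim\<close> lying between \<open>Z\<close> and \<open>Y\<close>.\<close>

section \<open>MU-categories\<close>

lemma (in MU_category) approx_refl: "f \<in> Arr L \<Longrightarrow> \<epsilon> > 0 \<Longrightarrow> approx L \<epsilon> f f"
  using dist_eq_0[of f "Dom L f" "Cod L f" f] by (simp add: approx_def hom_def)

lemma approx_mono: "approx L \<epsilon> f g \<Longrightarrow> \<epsilon> \<le> \<epsilon>' \<Longrightarrow> approx L \<epsilon>' f g"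
  unfolding approx_def by (meson ennreal_leI order_less_le_trans)

lemma (in MU_category) approx_trans:
  assumes "f \<in> hom L X Y" "g \<in> hom L X Y" "h \<in> hom L X Y"
    and "approx L (\<epsilon>/2) f g" "approx L (\<epsilon>/2) g h"
  shows "approx L \<epsilon> f h"
proof -
  \<comment> \<open>\<open>ennreal\<close> sends nonpositive reals to 0, and no distance is below 0,
    so a strict bound forces positivity. It is used below to split \<open>ennreal \<epsilon>\<close>
    into two halves.\<close>
  have "\<epsilon> > 0"
    using assms(4) unfolding approx_def
    by (metis ennreal_eq_0_iff half_gt_zero_iff linorder_not_le not_less_zero)
  have "Dist L f h \<le> Dist L f g + Dist L g h"
    using assms dist_triangle by blast
  also have "\<dots> < ennreal (\<epsilon>/2) + ennreal (\<epsilon>/2)"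
    using assms(4,5) unfolding approx_def by (rule add_strict_mono)
  also have "\<dots> = ennreal \<epsilon>"
    using \<open>\<epsilon> > 0\<close> by (simp flip: ennreal_plus)
  finally show ?thesis by (simp add: approx_def)
qed

lemma (in MU_category) approx_precomp:
  "f \<in> hom L X Y \<Longrightarrow> g \<in> hom L Y Z \<Longrightarrow> h \<in> hom L Y Z \<Longrightarrow> approx L \<epsilon> g h \<Longrightarrow>
    approx L \<epsilon> (g \<cdot> f) (h \<cdot> f)"
  unfolding approx_def using dist_precomp order_le_less_trans by blast

lemma (in MU_category) hom_obj:
  "f \<in> hom L X Y \<Longrightarrow> X \<in> Obj L" "f \<in> hom L X Y \<Longrightarrow> Y \<in> Obj L"
  using dom_obj cod_obj by (auto simp: hom_def)

lemma (in MU_category) postcomp_delta: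
  assumes "f \<in> hom L X Y" "\<epsilon> > 0"
  obtains \<delta> where "\<delta> > 0" "\<And>W g h. g \<in> hom L W X \<Longrightarrow> h \<in> hom L W X \<Longrightarrow>
    approx L \<delta> g h \<Longrightarrow> approx L \<epsilon> (f \<cdot> g) (f \<cdot> h)"
proof -
  have "f \<in> Arr L" "Dom L f = X" using assms(1) by (auto simp: hom_def)
  with postcomp_uniform[OF this(1) assms(2)] obtain \<delta> where "\<delta> > 0"
    "\<forall>W\<in>Obj L. \<forall>g\<in>hom L W X. \<forall>h\<in>hom L W X. approx L \<delta> g h \<longrightarrow> approx L \<epsilon> (f \<cdot> g) (f \<cdot> h)"
    by auto
  then show ?thesis using that hom_obj(1) by blast
qed

text \<open>The minimum of finitely many moduli serves all the maps at once. It will be applied to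
  the bonding maps from one term of a sequence to all earlier terms.\<close>

lemma (in MU_category) postcomp_delta_finite:
  assumes "finite F" "\<epsilon> > 0" "\<And>f. f \<in> F \<Longrightarrow> f \<in> Arr L \<and> Dom L f = X"
  shows "\<exists>\<delta>>0. \<forall>f\<in>F. \<forall>W. \<forall>g\<in>hom L W X. \<forall>h\<in>hom L W X.
    approx L \<delta> g h \<longrightarrow> approx L \<epsilon> (f \<cdot> g) (f \<cdot> h)"
  using assms(1,3)
proof (induction F)
  case empty
  show ?case by (rule exI[of _ 1]) simp
next
  case (insert f F)
  obtain \<delta> where \<delta>: "\<delta> > 0" "\<forall>f\<in>F. \<forall>W. \<forall>g\<in>hom L W X. \<forall>h\<in>hom L W X.
    approx L \<delta> g h \<longrightarrow> approx L \<epsilon> (f \<cdot> g) (f \<cdot> h)"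
    using insert by auto
  have "f \<in> hom L X (Cod L f)" using insert.prems[of f] by (simp add: hom_def)
  then obtain \<delta>' where \<delta>': "\<delta>' > 0" "\<And>W g h. g \<in> hom L W X \<Longrightarrow> h \<in> hom L W X \<Longrightarrow>
    approx L \<delta>' g h \<Longrightarrow> approx L \<epsilon> (f \<cdot> g) (f \<cdot> h)"
    using postcomp_delta[OF _ assms(2)] by blast
  show ?case
  proof (intro exI[of _ "min \<delta> \<delta>'"] conjI ballI allI impI)
    show "min \<delta> \<delta>' > 0" using \<delta> \<delta>' by simp
    fix k W g h assume *: "k \<in> insert f F" "g \<in> hom L W X" "h \<in> hom L W X" "approx L (min \<delta> \<delta>') g h"
    have "approx L \<delta> g h" "approx L \<delta>' g h" using approx_mono[OF *(4)] by simp_all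
    with * \<delta>(2) \<delta>'(2) show "approx L \<epsilon> (k \<cdot> g) (k \<cdot> h)" by blast
  qed
qed

lemma (in MU_category) ident_left: "f \<in> hom L X Y \<Longrightarrow> Ident L Y \<cdot> f = f"
  and ident_right: "f \<in> hom L X Y \<Longrightarrow> f \<cdot> Ident L X = f"
  using comp_ident_left comp_ident_right by (auto simp: hom_def)

text \<open>The leg of a cone into the new first object is forced to be \<open>e\<close> composed
  with the next leg. Cones over the two sequences therefore correspond, with the same mediating
  maps.\<close>

lemma (in MU_category) is_limit_prepend:
  assumes lim: "is_limit L X f Z p" and e: "e \<in> hom L (X 0) Y"
  shows "is_limit L (case_nat Y X) (case_nat e f) Z (case_nat (e \<cdot> p 0) p)"
  unfolding is_limit_def
proof (intro conjI allI impI)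
  have cone: "is_cone L X f Z p" using lim by (simp add: is_limit_def)
  then have p: "p n \<in> hom L Z (X n)" "f n \<cdot> p (Suc n) = p n" for n by (auto simp: is_cone_def)
  show "is_cone L (case_nat Y X) (case_nat e f) Z (case_nat (e \<cdot> p 0) p)"
    using cone comp_hom[OF p(1) e] by (auto simp: is_cone_def split: nat.split)
  fix W q assume q: "is_cone L (case_nat Y X) (case_nat e f) W q"
  then have qh: "q n \<in> hom L W (case_nat Y X n)" "case_nat e f n \<cdot> q (Suc n) = q n" for n
    unfolding is_cone_def by blast+
  have q0: "e \<cdot> q (Suc 0) = q 0" using qh(2)[of 0] by simp
  have "q (Suc n) \<in> hom L W (X n)" "f n \<cdot> q (Suc (Suc n)) = q (Suc n)" for n
    using qh[of "Suc n"] by simp_all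
  then have "is_cone L X f W (\<lambda>n. q (Suc n))"
    using q by (auto simp: is_cone_def)
  then have ex: "\<exists>!h. h \<in> hom L W Z \<and> (\<forall>n. p n \<cdot> h = q (Suc n))"
    using lim by (simp add: is_limit_def)
  have "(\<forall>n. case_nat (e \<cdot> p 0) p n \<cdot> h = q n) \<longleftrightarrow> (\<forall>n. p n \<cdot> h = q (Suc n))"
    if h: "h \<in> hom L W Z" for h
  proof
    assume *: "\<forall>n. p n \<cdot> h = q (Suc n)"
    have "(e \<cdot> p 0) \<cdot> h = q 0" using comp_assoc[OF h p(1) e] * q0 by simp
    with * show "\<forall>n. case_nat (e \<cdot> p 0) p n \<cdot> h = q n" by (simp split: nat.split)
  next
    assume *: "\<forall>n. case_nat (e \<cdot> p 0) p n \<cdot> h = q n"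
    show "\<forall>n. p n \<cdot> h = q (Suc n)" using *[rule_format, of "Suc _"] by simp
  qed
  then have "h \<in> hom L W Z \<and> (\<forall>n. case_nat (e \<cdot> p 0) p n \<cdot> h = q n) \<longleftrightarrow>
      h \<in> hom L W Z \<and> (\<forall>n. p n \<cdot> h = q (Suc n))" for h
    by blast
  with ex show "\<exists>!h. h \<in> hom L W Z \<and> (\<forall>n. case_nat (e \<cdot> p 0) p n \<cdot> h = q n)"
    by simp
qed

text \<open>A cone over the tail extends in exactly one way to the whole sequence, the missing leg
  being \<open>f 0 \<cdot> q 0\<close>, so the universal property carries over.\<close>

lemma (in MU_category) is_limit_tail:
  assumes lim: "is_limit L X f Z p" and f: "f 0 \<in> hom L (X (Suc 0)) (X 0)"
  shows "is_limit L (\<lambda>n. X (Suc n)) (\<lambda>n. f (Suc n)) Z (\<lambda>n. p (Suc n))"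
  unfolding is_limit_def
proof (intro conjI allI impI)
  have cone: "is_cone L X f Z p" using lim by (simp add: is_limit_def)
  then have p: "p n \<in> hom L Z (X n)" "f n \<cdot> p (Suc n) = p n" for n by (auto simp: is_cone_def)
  show "is_cone L (\<lambda>n. X (Suc n)) (\<lambda>n. f (Suc n)) Z (\<lambda>n. p (Suc n))"
    using cone by (auto simp: is_cone_def)
  fix W q assume q: "is_cone L (\<lambda>n. X (Suc n)) (\<lambda>n. f (Suc n)) W q"
  then have qh: "q n \<in> hom L W (X (Suc n))" "f (Suc n) \<cdot> q (Suc n) = q n" for n
    by (auto simp: is_cone_def)
  have "is_cone L X f W (case_nat (f 0 \<cdot> q 0) q)"
    using q qh comp_hom[OF qh(1) f] by (auto simp: is_cone_def split: nat.split)
  then have ex: "\<exists>!h. h \<in> hom L W Z \<and> (\<forall>n. p n \<cdot> h = case_nat (f 0 \<cdot> q 0) q n)"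
    using lim by (simp add: is_limit_def)
  have "(\<forall>n. p n \<cdot> h = case_nat (f 0 \<cdot> q 0) q n) \<longleftrightarrow> (\<forall>n. p (Suc n) \<cdot> h = q n)"
    if h: "h \<in> hom L W Z" for h
  proof
    assume *: "\<forall>n. p (Suc n) \<cdot> h = q n"
    have "p 0 \<cdot> h = f 0 \<cdot> q 0" using comp_assoc[OF h p(1) f] * p(2)[of 0] by simp
    with * show "\<forall>n. p n \<cdot> h = case_nat (f 0 \<cdot> q 0) q n" by (simp split: nat.split)
  next
    assume *: "\<forall>n. p n \<cdot> h = case_nat (f 0 \<cdot> q 0) q n"
    show "\<forall>n. p (Suc n) \<cdot> h = q n" using *[rule_format, of "Suc _"] by simp
  qed
  then have "h \<in> hom L W Z \<and> (\<forall>n. p (Suc n) \<cdot> h = q n) \<longleftrightarrow>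
      h \<in> hom L W Z \<and> (\<forall>n. p n \<cdot> h = case_nat (f 0 \<cdot> q 0) q n)" for h
    by blast
  with ex show "\<exists>!h. h \<in> hom L W Z \<and> (\<forall>n. p (Suc n) \<cdot> h = q n)"
    by simp
qed

section \<open>Elementary properties of the closure operators\<close>

lemma subset_cl_cat: "F \<subseteq> cl_cat L F"
  by (auto simp: cl_cat_def)

lemma cl_cat_least: "subcategory L C \<Longrightarrow> F \<subseteq> C \<Longrightarrow> cl_cat L F \<subseteq> C"
  by (auto simp: cl_cat_def)

lemma local_closure_iff:
  "h \<in> local_closure L F \<longleftrightarrow> h \<in> Arr L \<and> Dom L h \<in> Obj L \<and> Cod L h \<in> Obj L \<and>
    (\<forall>\<epsilon>>0. \<exists>f\<in>F \<inter> hom L (Dom L h) (Cod L h). approx L \<epsilon> f h)"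
  by (auto simp: local_closure_def metric_closure_def hom_def)

lemma (in MU_category) subset_local_closure:
  assumes "F \<subseteq> Arr L" shows "F \<subseteq> local_closure L F"
proof
  fix h assume h: "h \<in> F"
  then have "h \<in> Arr L" using assms by blast
  moreover have "h \<in> F \<inter> hom L (Dom L h) (Cod L h)"
    using h assms by (auto simp: hom_def)
  ultimately show "h \<in> local_closure L F"
    unfolding local_closure_iff using approx_refl dom_obj cod_obj by blast
qed

lemma (in MU_category) subcategory_Arr: "subcategory L (Arr L)"
proof -
  have "g \<cdot> f \<in> Arr L" if "f \<in> Arr L" "g \<in> Arr L" "Cod L f = Dom L g" for f g
    using comp_hom[of f "Dom L f" "Cod L f" g "Cod L g"] that by (simp add: hom_def)
  moreover have "Ident L X \<in> Arr L" if "X \<in> Obj L" for X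
    using ident_hom[OF that] by (simp add: hom_def)
  ultimately show ?thesis
    unfolding subcategory_def using dom_obj cod_obj by simp
qed

lemma (in MU_category) cl_cat_Arr: "F \<subseteq> Arr L \<Longrightarrow> cl_cat L F \<subseteq> Arr L"
  using cl_cat_least[OF subcategory_Arr] .

lemma local_closure_Arr: "local_closure L F \<subseteq> Arr L"
  by (auto simp: local_closure_def metric_closure_def hom_def)

lemma local_closure_mono: "F \<subseteq> G \<Longrightarrow> local_closure L F \<subseteq> local_closure L G"
proof
  assume FG: "F \<subseteq> G"
  fix h assume h: "h \<in> local_closure L F"
  have "\<exists>f\<in>G \<inter> hom L (Dom L h) (Cod L h). approx L \<epsilon> f h" if "\<epsilon> > 0" for \<epsilon>
  proof -
    have "\<exists>f\<in>F \<inter> hom L (Dom L h) (Cod L h). approx L \<epsilon> f h"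
      using h that by (simp add: local_closure_iff)
    with FG show ?thesis by blast
  qed
  with h show "h \<in> local_closure L G" by (simp add: local_closure_iff)
qed

lemma local_closure_witness:
  assumes "h \<in> local_closure L F"
  obtains f where "f \<in> F" "f \<in> hom L (Dom L h) (Cod L h)"
proof -
  have "\<forall>\<epsilon>>0. \<exists>f\<in>F \<inter> hom L (Dom L h) (Cod L h). approx L \<epsilon> f h"
    using assms by (simp add: local_closure_iff)
  from this[rule_format, of 1] have "\<exists>f\<in>F \<inter> hom L (Dom L h) (Cod L h). approx L 1 f h"
    by simp
  then show ?thesis using that by blast
qed

lemma subset_cl_lim: "F \<subseteq> cl_lim L K F"
  by (auto simp: cl_lim_def)

lemma subset_cl_refl: "F \<subseteq> cl_refl L K F"
  by (auto simp: cl_refl_def)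

lemma (in MU_category) cl_lim_Arr: "F \<subseteq> Arr L \<Longrightarrow> cl_lim L K F \<subseteq> Arr L"
  by (auto simp: cl_lim_def is_limit_def is_cone_def hom_def)

lemma (in MU_category) subcategory_ident:
  "subcategory L C \<Longrightarrow> f \<in> C \<Longrightarrow> Dom L f \<in> objs L C \<and> Cod L f \<in> objs L C"
  using dom_obj cod_obj by (auto simp: subcategory_def objs_def)

section \<open>Stages of the iteration\<close>

text \<open>Well-founded induction along the strict part of \<open>r\<close>, with the recursion
  equations already substituted. \<open>P\<close> also takes the index, so that a property may
  distinguish the zero stage from the later ones.\<close>

lemma sigma_stage_induct [consumes 1, case_names zero succ limit]:
  assumes r: "Well_order r"
    and "\<And>a. underS r a = {} \<Longrightarrow> P a (sigma_start L K)"
    and "\<And>a b. immediate_pred r b a \<Longrightarrow> P b (sigma_stage L K r b) \<Longrightarrow>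
      P a (sigma_step L K (sigma_stage L K r b))"
    and "\<And>a. underS r a \<noteq> {} \<Longrightarrow> \<nexists>b. immediate_pred r b a \<Longrightarrow>
      (\<And>b. b \<in> underS r a \<Longrightarrow> P b (sigma_stage L K r b)) \<Longrightarrow>
      P a (\<Union>b\<in>underS r a. sigma_stage L K r b)"
  shows "P a (sigma_stage L K r a)"
proof -
  have "wf (r - Id)" using r by (simp add: well_order_on_def)
  then show ?thesis
  proof (induction a rule: wf_induct_rule)
    case (less a)
    then have IH: "P b (sigma_stage L K r b)" if "b \<in> underS r a" for b
      using that by (auto simp: underS_def)
    consider "underS r a = {}" | b where "immediate_pred r b a"
      | "underS r a \<noteq> {}" "\<nexists>b. immediate_pred r b a" by blast
    then show ?case
    proof cases
      case 1
      then show ?thesis using assms(2) sigma_stage_zero[OF r] by metis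
    next
      case 2
      then show ?thesis using assms(3) IH sigma_stage_succ[OF r] by (metis immediate_pred_def)
    next
      case 3
      then show ?thesis using assms(4) IH sigma_stage_limit[OF r] by metis
    qed
  qed
qed

lemma Well_order_omega1: "Well_order omega1"
  unfolding omega1_def using cardSuc_Card_order natLeq_Card_order card_order_on_well_order_on by blast

lemma infinite_Field_omega1: "infinite (Field omega1)"
  unfolding omega1_def
  using cardSuc_finite natLeq_Card_order Field_natLeq infinite_UNIV_nat by metis

text \<open>This index carries the stage \<A>0, which is how \<open>sigma_start\<close> enters the
  \<sigma>-closure.\<close>

lemma underS_zero_ex: "\<exists>a\<in>Field omega1. underS omega1 a = {}"
proof -
  let ?r = omega1
  have "wf (?r - Id)" using Well_order_omega1 by (simp add: well_order_on_def)
  moreover obtain x where "x \<in> Field ?r" using infinite_Field_omega1 by fastforce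
  ultimately obtain a where a: "a \<in> Field ?r" "\<And>y. (y, a) \<in> ?r - Id \<Longrightarrow> y \<notin> Field ?r"
    using wfE_min by metis
  then have "underS ?r a = {}" by (auto simp: underS_def Field_def)
  with a show ?thesis by blast
qed

text \<open>Of two distinct elements one strictly precedes the other by totality. Such an index
  guarantees that the \<sigma>-closure reaches beyond \<A>0.\<close>

lemma underS_nonzero_ex: "\<exists>a\<in>Field omega1. underS omega1 a \<noteq> {}"
proof -
  obtain x y where xy: "x \<in> Field omega1" "y \<in> Field omega1" "x \<noteq> y"
    using infinite_Field_omega1
    by (metis finite.emptyI finite.insertI finite_subset singletonI subsetI)
  then have "(x, y) \<in> omega1 \<or> (y, x) \<in> omega1"
    using wo_rel.TOTALS[of omega1] Well_order_omega1 by (auto simp: wo_rel_def)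
  with xy show ?thesis by (auto simp: underS_def)
qed

section \<open>Limits of sequences and stage objects\<close>

locale MU_subcategory = MU_category L for L :: "('o, 'a) mucat" (structure) +
  fixes K :: "'a set"
  assumes subcategory_K: "subcategory L K"
begin

lemma K_Arr: "K \<subseteq> Arr L"
  using subcategory_K by (simp add: subcategory_def)

lemma K_comp: "f \<in> K \<Longrightarrow> g \<in> K \<Longrightarrow> f \<in> hom L X Y \<Longrightarrow> g \<in> hom L Y Z \<Longrightarrow> g \<cdot> f \<in> K"
  using subcategory_K by (auto simp: subcategory_def hom_def)

lemma K_obj: "f \<in> K \<Longrightarrow> f \<in> hom L X Y \<Longrightarrow> X \<in> objs L K \<and> Y \<in> objs L K"
  using subcategory_ident[OF subcategory_K] by (auto simp: hom_def)

definition limit_seq :: "(nat \<Rightarrow> 'o) \<Rightarrow> (nat \<Rightarrow> 'a) \<Rightarrow> 'o \<Rightarrow> (nat \<Rightarrow> 'a) \<Rightarrow> bool" where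
  "limit_seq X f Z p \<longleftrightarrow> K_sequence L K X f \<and> is_limit L X f Z p"

lemma limit_seqD:
  assumes "limit_seq X f Z p"
  shows "f n \<in> K" "f n \<in> hom L (X (Suc n)) (X n)" "p n \<in> hom L Z (X n)"
    "f n \<cdot> p (Suc n) = p n" "X n \<in> objs L K"
  using assms K_obj unfolding limit_seq_def K_sequence_def is_limit_def is_cone_def by blast+

lemma bond_K:
  assumes "K_sequence L K X f" "i \<le> j"
  shows "bond L X f i j \<in> K" "bond L X f i j \<in> hom L (X j) (X i)"
proof -
  have f: "f n \<in> K" "f n \<in> hom L (X (Suc n)) (X n)" for n
    using assms by (auto simp: K_sequence_def)
  then have id: "Ident L (X n) \<in> K" "Ident L (X n) \<in> hom L (X n) (X n)" for n
    using K_obj[OF f] ident_hom by (auto simp: objs_def)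
  have "bond L X f i j \<in> K \<and> bond L X f i j \<in> hom L (X j) (X i)"
    using assms(2)
  proof (induction j)
    case (Suc j)
    then show ?case
      using id f comp_hom[of "f j" "X (Suc j)" "X j" _ "X i"] K_comp[of "f j" _ "X (Suc j)" "X j" "X i"]
      by (cases "i \<le> j") (auto simp: le_Suc_eq)
  qed (use id in auto)
  then show "bond L X f i j \<in> K" "bond L X f i j \<in> hom L (X j) (X i)" by auto
qed

lemma bond_cone:
  assumes "limit_seq X f Z p" "i \<le> j"
  shows "bond L X f i j \<cdot> p j = p i"
  using assms(2)
proof (induction j)
  case 0
  then show ?case using ident_left[OF limit_seqD(3)[OF assms(1)]] by simp
next
  case (Suc j)
  have seq: "K_sequence L K X f" using assms(1) by (simp add: limit_seq_def)
  show ?case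
  proof (cases "i \<le> j")
    case True
    then show ?thesis
      using Suc comp_assoc[OF limit_seqD(3,2)[OF assms(1)] bond_K(2)[OF seq True]]
      by (simp add: limit_seqD(4)[OF assms(1)])
  next
    case False
    then have "i = Suc j" using Suc by simp
    then show ?thesis using ident_left[OF limit_seqD(3)[OF assms(1)]] by simp
  qed
qed

lemma limit_seq_tail:
  assumes "limit_seq X f Z p"
  shows "limit_seq (\<lambda>n. X (m + n)) (\<lambda>n. f (m + n)) Z (\<lambda>n. p (m + n))"
proof (induction m)
  case (Suc m)
  then have "is_limit L (\<lambda>n. X (m + Suc n)) (\<lambda>n. f (m + Suc n)) Z (\<lambda>n. p (m + Suc n))"
    using is_limit_tail[where X = "\<lambda>n. X (m + n)" and f = "\<lambda>n. f (m + n)" and p = "\<lambda>n. p (m + n)"]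
      limit_seqD(2)[OF Suc, of 0]
    by (simp add: limit_seq_def)
  then show ?case
    using assms by (simp add: limit_seq_def K_sequence_def)
qed (use assms in simp)

text \<open>Drop the first \<open>m\<close> terms and put \<open>Y\<close> in front, with
  \<open>e\<close> as the first bonding map. Thus every composite \<open>e \<cdot> p m\<close> is
  itself a leg of a limit cone of a sequence in \<open>K\<close>.\<close>

lemma limit_seq_prepend:
  assumes "limit_seq X f Z p" "e \<in> K" "e \<in> hom L (X m) Y"
  obtains X' f' p' where "limit_seq X' f' Z p'" "p' 0 = e \<cdot> p m"
proof -
  note t = limit_seq_tail[OF assms(1), of m]
  have "is_limit L (case_nat Y (\<lambda>n. X (m + n))) (case_nat e (\<lambda>n. f (m + n))) Z
    (case_nat (e \<cdot> p (m + 0)) (\<lambda>n. p (m + n)))"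
    using t assms(3) by (intro is_limit_prepend) (auto simp: limit_seq_def)
  moreover have "K_sequence L K (case_nat Y (\<lambda>n. X (m + n))) (case_nat e (\<lambda>n. f (m + n)))"
    using t assms(2,3) by (auto simp: limit_seq_def K_sequence_def split: nat.split)
  ultimately show ?thesis using that by (fastforce simp: limit_seq_def)
qed

text \<open>All legs of a cone over a constant sequence of identities agree, so the common leg is
  the mediating map. Through this sequence objects of \<open>K\<close> are treated as
  limits.\<close>

lemma limit_seq_const:
  assumes "X \<in> objs L K"
  shows "limit_seq (\<lambda>_. X) (\<lambda>_. Ident L X) X (\<lambda>_. Ident L X)"
proof -
  have X: "X \<in> Obj L" "Ident L X \<in> K" "Ident L X \<in> hom L X X"
    using assms ident_hom by (auto simp: objs_def)
  have cone_const: "q n = q 0" if "is_cone L (\<lambda>_. X) (\<lambda>_. Ident L X) W q" for W q n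
  proof (induction n)
    case (Suc n)
    then show ?case using that ident_left unfolding is_cone_def by metis
  qed simp
  have "\<exists>!h. h \<in> hom L W X \<and> (\<forall>n. Ident L X \<cdot> h = q n)"
    if q: "is_cone L (\<lambda>_. X) (\<lambda>_. Ident L X) W q" for W q
  proof (rule ex1I[of _ "q 0"])
    have "q 0 \<in> hom L W X" using q by (simp add: is_cone_def)
    then show "q 0 \<in> hom L W X \<and> (\<forall>n. Ident L X \<cdot> q 0 = q n)"
      using cone_const[OF q] ident_left by metis
  qed (metis ident_left)
  then show ?thesis
    using X ident_left[OF X(3)] by (auto simp: limit_seq_def K_sequence_def is_limit_def is_cone_def)
qed

section \<open>Limit objects and the maps between them\<close>

definition limit_objs :: "'o set" where
  "limit_objs = {Z. \<exists>X f p. limit_seq X f Z p}"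

lemma limit_objsI: "limit_seq X f Z p \<Longrightarrow> Z \<in> limit_objs"
  by (auto simp: limit_objs_def)

lemma objs_K_limit_objs: "objs L K \<subseteq> limit_objs"
  using limit_seq_const by (auto simp: limit_objs_def)

lemma limit_objs_Obj: "limit_objs \<subseteq> Obj L"
  using limit_seqD(3) hom_obj(1) by (fastforce simp: limit_objs_def)

text \<open>The bonding maps of a sequence in \<open>K\<close> are composites of maps in
  \<open>K\<close>, hence in \<open>K\<close>, so the side condition of \<open>cl_lim\<close> holds
  automatically for the family \<open>K\<close>.\<close>

lemma cl_lim_K: "cl_lim L K K = K \<union> {p n | p n. \<exists>X f Z. limit_seq X f Z p}"
  unfolding cl_lim_def limit_seq_def using bond_K by blast

lemma limit_map_cl_lim: "limit_seq X f Z p \<Longrightarrow> p n \<in> cl_lim L K K"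
  by (auto simp: cl_lim_K)

lemma cl_lim_sigma_start: "cl_lim L K K \<subseteq> sigma_start L K"
  unfolding sigma_start_def
  using subset_cl_cat subset_local_closure cl_cat_Arr cl_lim_Arr K_Arr by (meson order_trans)

text \<open>The full subcategory on the limit objects. It is the invariant of the transfinite
  iteration: none of the closure operations leads out of it.\<close>

definition arrows_on_limits :: "'a set" where
  "arrows_on_limits = maps_between L limit_objs limit_objs"

lemma arrows_on_limitsI:
  "f \<in> hom L X Y \<Longrightarrow> X \<in> limit_objs \<Longrightarrow> Y \<in> limit_objs \<Longrightarrow> f \<in> arrows_on_limits"
  by (auto simp: arrows_on_limits_def maps_between_def hom_def)

lemma cl_cat_on_limits:
  assumes "F \<subseteq> arrows_on_limits" shows "cl_cat L F \<subseteq> arrows_on_limits"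
proof (rule cl_cat_least[OF _ assms])
  have "Ident L X \<in> hom L X X" if "X \<in> limit_objs" for X
    using that limit_objs_Obj ident_hom by blast
  then show "subcategory L arrows_on_limits"
    using comp_hom unfolding subcategory_def arrows_on_limits_def maps_between_def hom_def
    by fastforce
qed

lemma local_closure_on_limits:
  assumes "F \<subseteq> arrows_on_limits" shows "local_closure L F \<subseteq> arrows_on_limits"
proof
  fix h assume h: "h \<in> local_closure L F"
  then obtain f where "f \<in> F" "f \<in> hom L (Dom L h) (Cod L h)" by (rule local_closure_witness)
  with assms h local_closure_Arr show "h \<in> arrows_on_limits"
    by (fastforce simp: arrows_on_limits_def maps_between_def hom_def)
qed

lemma cl_lim_on_limits: "cl_lim L K K \<subseteq> arrows_on_limits"
proof
  fix k assume "k \<in> cl_lim L K K"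
  then consider "k \<in> K" | X f Z p n where "limit_seq X f Z p" "k = p n"
    by (auto simp: cl_lim_K)
  then show "k \<in> arrows_on_limits"
  proof cases
    case 1
    then show ?thesis
      using K_obj K_Arr objs_K_limit_objs unfolding arrows_on_limits_def maps_between_def hom_def
      by blast
  next
    case 2
    then show ?thesis
      using arrows_on_limitsI[OF limit_seqD(3)[OF 2(1)] limit_objsI[OF 2(1)]]
        limit_seqD(5)[OF 2(1)] objs_K_limit_objs by blast
  qed
qed

text \<open>A map \<open>h\<close> added by reflection ends in a limit object by definition, and it
  starts in one because \<open>p 0 \<cdot> h\<close> has the same domain and belongs to
  \<open>F\<close>.\<close>

lemma cl_refl_on_limits:
  assumes "F \<subseteq> arrows_on_limits" shows "cl_refl L K F \<subseteq> arrows_on_limits"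
proof
  fix h assume "h \<in> cl_refl L K F"
  then consider "h \<in> F" | X f p where "h \<in> Arr L" "limit_seq X f (Cod L h) p" "p 0 \<cdot> h \<in> F"
    by (auto simp: cl_refl_def limit_seq_def)
  then show "h \<in> arrows_on_limits"
  proof cases
    case 1
    then show ?thesis using assms by auto
  next
    case 2
    have "p 0 \<cdot> h \<in> hom L (Dom L h) (X 0)"
      using 2(1) limit_seqD(3)[OF 2(2)] by (intro comp_hom) (auto simp: hom_def)
    then show ?thesis
      using 2(1,3) limit_objsI[OF 2(2)] assms
      by (auto simp: arrows_on_limits_def maps_between_def hom_def)
  qed
qed

lemma sigma_start_on_limits: "sigma_start L K \<subseteq> arrows_on_limits"
  unfolding sigma_start_def
  by (intro local_closure_on_limits cl_cat_on_limits cl_lim_on_limits)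

lemma sigma_step_on_limits: "F \<subseteq> arrows_on_limits \<Longrightarrow> sigma_step L K F \<subseteq> arrows_on_limits"
  unfolding sigma_step_def
  by (intro local_closure_on_limits cl_cat_on_limits cl_refl_on_limits)

lemma sigma_stage_on_limits: "Well_order r \<Longrightarrow> sigma_stage L K r a \<subseteq> arrows_on_limits"
  by (induction a rule: sigma_stage_induct) (auto dest: sigma_start_on_limits[THEN subsetD] sigma_step_on_limits)

lemma sigma_start_subset_closure: "sigma_start L K \<subseteq> sigma_closure L K"
proof -
  obtain a where a: "a \<in> Field omega1" "underS omega1 a = {}" using underS_zero_ex by blast
  have "sigma_start L K = sigma_stage L K omega1 a"
    by (rule sigma_stage_zero[OF Well_order_omega1 a(2), symmetric])
  with a(1) show ?thesis unfolding sigma_closure_def by blast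
qed

text \<open>The invariant \<open>arrows_on_limits\<close> bounds the objects from above. Conversely,
  every limit object is the domain of a leg in \<open>cl_lim L K K\<close>, so its identity appears
  already in \<A>0.\<close>

lemma objs_sigma_closure: "objs L (sigma_closure L K) = limit_objs"
proof
  have "sigma_closure L K \<subseteq> arrows_on_limits"
    using sigma_stage_on_limits[OF Well_order_omega1] by (auto simp: sigma_closure_def)
  moreover have "X \<in> limit_objs" if "X \<in> Obj L" "Ident L X \<in> arrows_on_limits" for X
    using ident_hom[OF that(1)] that(2) by (simp add: arrows_on_limits_def maps_between_def hom_def)
  ultimately show "objs L (sigma_closure L K) \<subseteq> limit_objs"
    by (auto simp: objs_def)
next
  show "limit_objs \<subseteq> objs L (sigma_closure L K)"
  proof
    fix Z assume Z: "Z \<in> limit_objs"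
    then obtain X f p where s: "limit_seq X f Z p" by (auto simp: limit_objs_def)
    have "Dom L (p 0) = Z" using limit_seqD(3)[OF s] by (simp add: hom_def)
    \<comment> \<open>A subcategory containing the leg \<open>p 0\<close> contains the identity of
      its domain, and \<open>cl_cat\<close> is the intersection of all such subcategories.\<close>
    then have "Ident L Z \<in> C" if "subcategory L C" "cl_lim L K K \<subseteq> C" for C
      using that limit_map_cl_lim[OF s, of 0] subcategory_ident[OF that(1), of "p 0"]
      by (auto simp: objs_def)
    then have "Ident L Z \<in> cl_cat L (cl_lim L K K)"
      by (simp add: cl_cat_def)
    then have "Ident L Z \<in> sigma_start L K"
      unfolding sigma_start_def
      using subset_local_closure[OF cl_cat_Arr[OF cl_lim_Arr[OF K_Arr]]] by blast
    with Z show "Z \<in> objs L (sigma_closure L K)"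
      using limit_objs_Obj sigma_start_subset_closure by (auto simp: objs_def)
  qed
qed

section \<open>Limits of pre-transformations\<close>

text \<open>This is D(Z, Y) of the opening comment. The sequence \<open>X\<close> and the cone
  \<open>p\<close> remain arguments because the set may depend on them as long as consistency is not
  assumed.\<close>

definition factor_closure :: "(nat \<Rightarrow> 'o) \<Rightarrow> 'o \<Rightarrow> (nat \<Rightarrow> 'a) \<Rightarrow> 'o \<Rightarrow> 'a set" where
  "factor_closure X Z p Y = {k \<in> hom L Z Y.
    \<forall>\<epsilon>>0. \<exists>m. \<exists>e\<in>K. e \<in> hom L (X m) Y \<and> approx L \<epsilon> (e \<cdot> p m) k}"

lemma factor_closureE:
  assumes "k \<in> factor_closure X Z p Y" "\<epsilon> > 0"
  obtains m e where "e \<in> K" "e \<in> hom L (X m) Y" "approx L \<epsilon> (e \<cdot> p m) k"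
  using assms by (auto simp: factor_closure_def)

lemma factor_closure_closed:
  assumes s: "limit_seq X f Z p" and k: "k \<in> hom L Z Y"
    and "\<And>\<epsilon>. \<epsilon> > 0 \<Longrightarrow> \<exists>k'\<in>factor_closure X Z p Y. approx L \<epsilon> k' k"
  shows "k \<in> factor_closure X Z p Y"
  unfolding factor_closure_def
proof (intro CollectI conjI k allI impI)
  fix \<epsilon> :: real assume "\<epsilon> > 0"
  then have \<epsilon>: "\<epsilon>/2 > 0" by simp
  obtain k' where k': "k' \<in> factor_closure X Z p Y" "approx L (\<epsilon>/2) k' k"
    using assms(3)[OF \<epsilon>] by blast
  then obtain m e where e: "e \<in> K" "e \<in> hom L (X m) Y" "approx L (\<epsilon>/2) (e \<cdot> p m) k'"
    using factor_closureE[OF _ \<epsilon>] by blast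
  have "k' \<in> hom L Z Y" using k'(1) by (simp add: factor_closure_def)
  then have "approx L \<epsilon> (e \<cdot> p m) k"
    using approx_trans comp_hom[OF limit_seqD(3)[OF s] e(2)] k e(3) k'(2) by blast
  with e show "\<exists>m. \<exists>e\<in>K. e \<in> hom L (X m) Y \<and> approx L \<epsilon> (e \<cdot> p m) k" by blast
qed

lemma factor_closure_K:
  assumes s: "limit_seq X f Z p" and "e \<in> K" "e \<in> hom L (X m) Y"
  shows "e \<cdot> p m \<in> factor_closure X Z p Y"
proof -
  have "e \<cdot> p m \<in> hom L Z Y" using comp_hom[OF limit_seqD(3)[OF s] assms(3)] .
  then show ?thesis
    using assms(2,3) approx_refl unfolding factor_closure_def hom_def by blast
qed

text \<open>Uniform continuity of composition with \<open>u\<close> turns a close approximant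
  \<open>e \<cdot> p m\<close> of \<open>k\<close> into an approximant
  \<open>(u \<cdot> e) \<cdot> p m\<close> of \<open>u \<cdot> k\<close>, and
  \<open>u \<cdot> e\<close> is again in \<open>K\<close>.\<close>

lemma factor_closure_comp_K:
  assumes s: "limit_seq X f Z p" and k: "k \<in> factor_closure X Z p Y"
    and u: "u \<in> K" "u \<in> hom L Y Y'"
  shows "u \<cdot> k \<in> factor_closure X Z p Y'"
proof -
  have kh: "k \<in> hom L Z Y" using k by (simp add: factor_closure_def)
  show ?thesis
    unfolding factor_closure_def
  proof (intro CollectI conjI comp_hom[OF kh u(2)] allI impI)
    fix \<epsilon> :: real assume "\<epsilon> > 0"
    then obtain \<delta> where \<delta>: "\<delta> > 0" "\<And>W g h. g \<in> hom L W Y \<Longrightarrow> h \<in> hom L W Y \<Longrightarrow>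
      approx L \<delta> g h \<Longrightarrow> approx L \<epsilon> (u \<cdot> g) (u \<cdot> h)"
      using postcomp_delta[OF u(2)] by blast
    obtain m e where e: "e \<in> K" "e \<in> hom L (X m) Y" "approx L \<delta> (e \<cdot> p m) k"
      using factor_closureE[OF k \<delta>(1)] .
    have "approx L \<epsilon> (u \<cdot> (e \<cdot> p m)) (u \<cdot> k)"
      using \<delta>(2) comp_hom[OF limit_seqD(3)[OF s] e(2)] kh e(3) by blast
    then have "approx L \<epsilon> ((u \<cdot> e) \<cdot> p m) (u \<cdot> k)"
      using comp_assoc[OF limit_seqD(3)[OF s] e(2) u(2)] by simp
    then show "\<exists>m. \<exists>e\<in>K. e \<in> hom L (X m) Y' \<and> approx L \<epsilon> (e \<cdot> p m) (u \<cdot> k)"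
      using K_comp[OF e(1) u(1) e(2) u(2)] comp_hom[OF e(2) u(2)] by blast
  qed
qed

text \<open>Approximate \<open>k\<close> by some \<open>e \<cdot> q m\<close>; composing with
  \<open>h\<close> on the right does not increase distances. The approximant
  \<open>e \<cdot> (q m \<cdot> h)\<close> lies in the closure by the preceding lemma, and
  closedness finishes.\<close>

lemma factor_closure_comp:
  assumes s: "limit_seq X f Z p" and t: "limit_seq Y g W q" and h: "h \<in> hom L Z W"
    and qh: "\<And>n. q n \<cdot> h \<in> factor_closure X Z p (Y n)"
    and k: "k \<in> factor_closure Y W q V"
  shows "k \<cdot> h \<in> factor_closure X Z p V"
proof (rule factor_closure_closed[OF s])
  have kh: "k \<in> hom L W V" using k by (simp add: factor_closure_def)
  then show "k \<cdot> h \<in> hom L Z V" using comp_hom[OF h] by blast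
  fix \<epsilon> :: real assume "\<epsilon> > 0"
  then obtain m e where e: "e \<in> K" "e \<in> hom L (Y m) V" "approx L \<epsilon> (e \<cdot> q m) k"
    using factor_closureE[OF k] by blast
  have "approx L \<epsilon> ((e \<cdot> q m) \<cdot> h) (k \<cdot> h)"
    using approx_precomp[OF h comp_hom[OF limit_seqD(3)[OF t] e(2)] kh e(3)] .
  moreover have "(e \<cdot> q m) \<cdot> h = e \<cdot> (q m \<cdot> h)"
    using comp_assoc[OF h limit_seqD(3)[OF t] e(2)] by simp
  ultimately show "\<exists>k'\<in>factor_closure X Z p V. approx L \<epsilon> k' (k \<cdot> h)"
    using factor_closure_comp_K[OF s qh e(1,2)] by auto
qed

text \<open>Inserting a bonding map raises the index without changing the composite with the cone.
  This freedom makes the index sequence of a pre-transformation strictly increasing.\<close>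

lemma factor_closure_late:
  assumes s: "limit_seq X f Z p" and k: "k \<in> factor_closure X Z p Y" and "\<epsilon> > 0"
  obtains m e where "m > N" "e \<in> K" "e \<in> hom L (X m) Y" "approx L \<epsilon> (e \<cdot> p m) k"
proof -
  obtain m e where e: "e \<in> K" "e \<in> hom L (X m) Y" "approx L \<epsilon> (e \<cdot> p m) k"
    using factor_closureE[OF k assms(3)] .
  let ?m = "max m (Suc N)"
  have seq: "K_sequence L K X f" using s by (simp add: limit_seq_def)
  note b = bond_K[OF seq, of m ?m, simplified]
  have "(e \<cdot> bond L X f m ?m) \<cdot> p ?m = e \<cdot> p m"
    using comp_assoc[OF limit_seqD(3)[OF s] b(2) e(2)] bond_cone[OF s, of m ?m] by simp
  then show ?thesis
    using that[of ?m "e \<cdot> bond L X f m ?m"] K_comp[OF b(1) e(1) b(2) e(2)] comp_hom[OF b(2) e(2)] e(3)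
    by auto
qed

text \<open>Forward, a single late term of the pre-transformation, composed with a bonding map,
  gives the required approximant. Backward, \<phi> n is chosen so close to
  \<open>q n \<cdot> h\<close> that the error stays below 1/(n+1) after every bonding map to an
  earlier term.\<close>

lemma pretrans_limit_iff:
  assumes s: "limit_seq X f Z p" and t: "limit_seq Y g W q" and h: "h \<in> hom L Z W"
  shows "(\<exists>s \<phi>. pre_transformation L K X Y s \<phi> \<and> is_pretrans_limit L p Y g q s \<phi> h) \<longleftrightarrow>
    (\<forall>n. q n \<cdot> h \<in> factor_closure X Z p (Y n))" (is "?L \<longleftrightarrow> ?R")
proof
  assume ?L
  then obtain \<sigma> \<phi> where pt: "pre_transformation L K X Y \<sigma> \<phi>" and lim: "is_pretrans_limit L p Y g q \<sigma> \<phi> h"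
    by blast
  have seq: "K_sequence L K Y g" using t by (simp add: limit_seq_def)
  show ?R
    unfolding factor_closure_def
  proof (intro allI CollectI conjI impI)
    fix n
    show "q n \<cdot> h \<in> hom L Z (Y n)" using comp_hom[OF h limit_seqD(3)[OF t]] .
    fix \<epsilon> :: real assume "\<epsilon> > 0"
    then obtain n' where n': "n' \<ge> n"
      "approx L \<epsilon> (bond L Y g n n' \<cdot> \<phi> n' \<cdot> p (\<sigma> n')) (q n \<cdot> h)"
      using lim unfolding is_pretrans_limit_def by blast
    have \<phi>: "\<phi> n' \<in> K" "\<phi> n' \<in> hom L (X (\<sigma> n')) (Y n')" using pt by (auto simp: pre_transformation_def)
    note b = bond_K[OF seq n'(1)]
    show "\<exists>m. \<exists>e\<in>K. e \<in> hom L (X m) (Y n) \<and> approx L \<epsilon> (e \<cdot> p m) (q n \<cdot> h)"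
      using n'(2) K_comp[OF \<phi>(1) b(1) \<phi>(2) b(2)] comp_hom[OF \<phi>(2) b(2)] by blast
  qed
next
  assume R: ?R
  have seq: "K_sequence L K Y g" using t by (simp add: limit_seq_def)
  have "\<exists>\<delta>>0. \<forall>k\<in>(\<lambda>i. bond L Y g i n) ` {..n}. \<forall>V. \<forall>u\<in>hom L V (Y n). \<forall>v\<in>hom L V (Y n).
    approx L \<delta> u v \<longrightarrow> approx L (inverse (real (Suc n))) (k \<cdot> u) (k \<cdot> v)" for n
    using bond_K(2)[OF seq] by (intro postcomp_delta_finite) (auto simp: hom_def)
  then obtain \<delta> where \<delta>: "\<And>n. \<delta> n > 0" "\<And>n i V u v. i \<le> n \<Longrightarrow> u \<in> hom L V (Y n) \<Longrightarrow>
    v \<in> hom L V (Y n) \<Longrightarrow> approx L (\<delta> n) u v \<Longrightarrow>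
    approx L (inverse (real (Suc n))) (bond L Y g i n \<cdot> u) (bond L Y g i n \<cdot> v)"
    by (metis atMost_iff image_eqI)
  \<comment> \<open>\<open>\<delta> n\<close> works for all bonding maps out of \<open>Y n\<close> at once, as the limit condition compares at every earlier level.\<close>
  let ?P = "\<lambda>n (m, e). e \<in> K \<and> e \<in> hom L (X m) (Y n) \<and> approx L (\<delta> n) (e \<cdot> p m) (q n \<cdot> h)"
  have ex: "\<exists>c. ?P n c \<and> N < fst c" for n N
  proof -
    obtain m e where "m > N" "e \<in> K" "e \<in> hom L (X m) (Y n)" "approx L (\<delta> n) (e \<cdot> p m) (q n \<cdot> h)"
      using factor_closure_late[OF s R[rule_format] \<delta>(1)] by blast
    then show ?thesis by (intro exI[of _ "(m, e)"]) simp
  qed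
  \<comment> \<open>Dependent choice on pairs of an index and a map; each index is taken beyond the
    previous one.\<close>
  have "\<exists>c. \<forall>n. ?P n (c n) \<and> fst (c n) < fst (c (Suc n))"
    by (rule dependent_nat_choice) (use ex in blast)+
  then obtain c where "\<forall>n. ?P n (c n) \<and> fst (c n) < fst (c (Suc n))" ..
  then have c: "?P n (c n)" "fst (c n) < fst (c (Suc n))" for n by simp_all
  define \<sigma> where "\<sigma> n = fst (c n)" for n
  define \<phi> where "\<phi> n = snd (c n)" for n
  have \<phi>: "\<phi> n \<in> K" "\<phi> n \<in> hom L (X (\<sigma> n)) (Y n)" "approx L (\<delta> n) (\<phi> n \<cdot> p (\<sigma> n)) (q n \<cdot> h)" for n
    using c(1)[of n] by (auto simp: \<sigma>_def \<phi>_def split_beta)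
  have "strict_mono \<sigma>" using c(2) by (simp add: strict_mono_Suc_iff \<sigma>_def)
  then have "pre_transformation L K X Y \<sigma> \<phi>"
    using \<phi> by (simp add: pre_transformation_def)
  moreover have "is_pretrans_limit L p Y g q \<sigma> \<phi> h"
    unfolding is_pretrans_limit_def
  proof (intro allI impI)
    fix n and \<epsilon> :: real assume "\<epsilon> > 0"
    then obtain N where N: "inverse (real (Suc N)) < \<epsilon>" using reals_Archimedean by blast
    \<comment> \<open>From \<open>n\<close> on the bonding map to \<open>Y n\<close> makes sense,
      and from \<open>N\<close> on the error 1/(n'+1) is below \<epsilon>; hence the threshold
      \<open>max n N\<close>.\<close>
    show "\<exists>n0\<ge>n. \<forall>n'\<ge>n0. approx L \<epsilon> (bond L Y g n n' \<cdot> \<phi> n' \<cdot> p (\<sigma> n')) (q n \<cdot> h)"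
    proof (intro exI[of _ "max n N"] conjI allI impI)
      fix n' assume n': "n' \<ge> max n N"
      note b = bond_K(2)[OF seq, of n n']
      have "inverse (real (Suc n')) \<le> inverse (real (Suc N))" using n' by simp
      with N have le: "inverse (real (Suc n')) \<le> \<epsilon>" by linarith
      have "approx L (inverse (real (Suc n'))) (bond L Y g n n' \<cdot> (\<phi> n' \<cdot> p (\<sigma> n')))
          (bond L Y g n n' \<cdot> (q n' \<cdot> h))"
        using n' \<phi> comp_hom[OF limit_seqD(3)[OF s] \<phi>(2)] comp_hom[OF h limit_seqD(3)[OF t]]
        by (intro \<delta>(2)) auto
      moreover have "bond L Y g n n' \<cdot> (\<phi> n' \<cdot> p (\<sigma> n')) = bond L Y g n n' \<cdot> \<phi> n' \<cdot> p (\<sigma> n')"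
        using n' by (intro comp_assoc[OF limit_seqD(3)[OF s] \<phi>(2) b]) auto
      moreover have "bond L Y g n n' \<cdot> (q n' \<cdot> h) = q n \<cdot> h"
        using n' comp_assoc[OF h limit_seqD(3)[OF t] b] bond_cone[OF t, of n n'] by simp
      ultimately show "approx L \<epsilon> (bond L Y g n n' \<cdot> \<phi> n' \<cdot> p (\<sigma> n')) (q n \<cdot> h)"
        using approx_mono[OF _ le] by simp
    qed simp
  qed
  ultimately show ?L by blast
qed

text \<open>From here on pre-transformations are replaced by the closure condition on the composites
  \<open>q n \<cdot> h\<close>.\<close>

lemma mem_sigma_exists:
  "h \<in> sigma_exists L K \<longleftrightarrow> h \<in> Arr L \<and> (\<exists>X f p Y g q. limit_seq X f (Dom L h) p \<and>
    limit_seq Y g (Cod L h) q \<and> (\<forall>n. q n \<cdot> h \<in> factor_closure X (Dom L h) p (Y n)))"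
  (is "_ \<longleftrightarrow> ?R")
proof -
  have iff: "(\<exists>s \<phi>. pre_transformation L K X Y s \<phi> \<and> is_pretrans_limit L p Y g q s \<phi> h) \<longleftrightarrow>
    (\<forall>n. q n \<cdot> h \<in> factor_closure X (Dom L h) p (Y n))"
    if "limit_seq X f (Dom L h) p" "limit_seq Y g (Cod L h) q" "h \<in> Arr L" for X f p Y g q
    using that by (intro pretrans_limit_iff[OF that(1,2)]) (simp add: hom_def)
  show ?thesis
  proof
    assume "h \<in> sigma_exists L K"
    then have "h \<in> Arr L" "\<exists>X f p Y g q. limit_seq X f (Dom L h) p \<and> limit_seq Y g (Cod L h) q \<and>
      (\<exists>s \<phi>. pre_transformation L K X Y s \<phi> \<and> is_pretrans_limit L p Y g q s \<phi> h)"
      unfolding sigma_exists_def limit_seq_def maps_between_def by auto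
    with iff show ?R by metis
  next
    assume ?R
    then obtain X f p Y g q where a: "h \<in> Arr L" "limit_seq X f (Dom L h) p" "limit_seq Y g (Cod L h) q"
      "\<forall>n. q n \<cdot> h \<in> factor_closure X (Dom L h) p (Y n)" by blast
    then have "\<exists>s \<phi>. pre_transformation L K X Y s \<phi> \<and> is_pretrans_limit L p Y g q s \<phi> h"
      using iff by blast
    moreover have "h \<in> maps_between L limit_objs limit_objs"
      using a by (auto simp: maps_between_def limit_objs_def)
    ultimately show "h \<in> sigma_exists L K"
      using a unfolding sigma_exists_def objs_sigma_closure limit_seq_def by blast
  qed
qed

text \<open>The conjunct \<open>h \<in> arrows_on_limits\<close> keeps the universal condition from
  being vacuous: both ends of \<open>h\<close> then have at least one sequence.\<close>

lemma mem_sigma_forall: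
  "h \<in> sigma_forall L K \<longleftrightarrow> h \<in> arrows_on_limits \<and> (\<forall>X f p Y g q. limit_seq X f (Dom L h) p \<longrightarrow>
    limit_seq Y g (Cod L h) q \<longrightarrow> (\<forall>n. q n \<cdot> h \<in> factor_closure X (Dom L h) p (Y n)))"
proof -
  have iff: "(\<exists>s \<phi>. pre_transformation L K X Y s \<phi> \<and> is_pretrans_limit L p Y g q s \<phi> h) \<longleftrightarrow>
    (\<forall>n. q n \<cdot> h \<in> factor_closure X (Dom L h) p (Y n))"
    if "limit_seq X f (Dom L h) p" "limit_seq Y g (Cod L h) q" "h \<in> arrows_on_limits" for X f p Y g q
    using that
    by (intro pretrans_limit_iff[OF that(1,2)]) (simp add: hom_def arrows_on_limits_def maps_between_def)
  have "h \<in> sigma_forall L K \<longleftrightarrow> h \<in> arrows_on_limits \<and>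
    (\<forall>X f p Y g q. limit_seq X f (Dom L h) p \<longrightarrow> limit_seq Y g (Cod L h) q \<longrightarrow>
      (\<exists>s \<phi>. pre_transformation L K X Y s \<phi> \<and> is_pretrans_limit L p Y g q s \<phi> h))"
    unfolding sigma_forall_def objs_sigma_closure arrows_on_limits_def limit_seq_def by blast
  with iff show ?thesis by (simp cong: conj_cong imp_cong)
qed

lemma sigma_forall_subset_exists: "sigma_forall L K \<subseteq> sigma_exists L K"
proof
  fix h assume h: "h \<in> sigma_forall L K"
  then have "h \<in> Arr L" "Dom L h \<in> limit_objs" "Cod L h \<in> limit_objs"
    by (auto simp: mem_sigma_forall arrows_on_limits_def maps_between_def)
  with h show "h \<in> sigma_exists L K"
    unfolding mem_sigma_forall mem_sigma_exists limit_objs_def by blast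
qed

lemma limit_map_factor_closure:
  assumes s: "limit_seq X f Z p"
  shows "p n \<in> factor_closure X Z p (X n)"
proof -
  have "Ident L (X n) \<in> K" "Ident L (X n) \<in> hom L (X n) (X n)"
    using limit_seqD(5)[OF s] ident_hom by (auto simp: objs_def)
  from factor_closure_K[OF s this] show ?thesis
    using ident_left[OF limit_seqD(3)[OF s]] by simp
qed

text \<open>Take the same sequence for source and target; each composite to be tested is then a leg
  \<open>p n\<close>, which factors through the identity of \<open>X n\<close>.\<close>

lemma ident_sigma_exists:
  assumes "Z \<in> limit_objs" shows "Ident L Z \<in> sigma_exists L K"
proof -
  obtain X f p where s: "limit_seq X f Z p" using assms by (auto simp: limit_objs_def)
  have id: "Ident L Z \<in> hom L Z Z" using assms limit_objs_Obj ident_hom by blast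
  then have "p n \<cdot> Ident L Z \<in> factor_closure X Z p (X n)" for n
    using ident_right[OF limit_seqD(3)[OF s]] limit_map_factor_closure[OF s] by simp
  moreover have "Ident L Z \<in> Arr L" "Dom L (Ident L Z) = Z" "Cod L (Ident L Z) = Z"
    using id by (auto simp: hom_def)
  ultimately show ?thesis unfolding mem_sigma_exists using s by metis
qed

lemma sigma_consistent_iff_factor_closure:
  "sigma_consistent L K \<longleftrightarrow> (\<forall>X f Y g Z p q n. limit_seq X f Z p \<longrightarrow> limit_seq Y g Z q \<longrightarrow>
    q n \<in> factor_closure X Z p (Y n))"
proof -
  have mem: "q n \<in> factor_closure X Z p (Y n) \<longleftrightarrow>
    (\<forall>\<epsilon>>0. \<exists>m. \<exists>h\<in>K. h \<in> hom L (X m) (Y n) \<and> approx L \<epsilon> (h \<cdot> p m) (q n))"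
    if "limit_seq Y g Z q" for X Y g Z p q n
    using limit_seqD(3)[OF that] by (simp add: factor_closure_def)
  show ?thesis
  proof
    assume C: "sigma_consistent L K"
    show "\<forall>X f Y g Z p q n. limit_seq X f Z p \<longrightarrow> limit_seq Y g Z q \<longrightarrow>
        q n \<in> factor_closure X Z p (Y n)"
    proof (intro allI impI)
      fix X f Y g Z p q n assume st: "limit_seq X f Z p" "limit_seq Y g Z q"
      then have "K_sequence L K X f \<and> is_limit L X f Z p \<and> K_sequence L K Y g \<and> is_limit L Y g Z q"
        by (simp add: limit_seq_def)
      from C[unfolded sigma_consistent_def, rule_format, OF this]
      show "q n \<in> factor_closure X Z p (Y n)" using mem[OF st(2)] by blast
    qed
  next
    assume R: "\<forall>X f Y g Z p q n. limit_seq X f Z p \<longrightarrow> limit_seq Y g Z q \<longrightarrow>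
        q n \<in> factor_closure X Z p (Y n)"
    show "sigma_consistent L K"
      unfolding sigma_consistent_def
    proof (intro allI impI)
      fix X f Y g Z p q n and \<epsilon> :: real
      assume "K_sequence L K X f \<and> is_limit L X f Z p \<and> K_sequence L K Y g \<and> is_limit L Y g Z q"
      then have "limit_seq X f Z p" "limit_seq Y g Z q" by (auto simp: limit_seq_def)
      then have "q n \<in> factor_closure X Z p (Y n)" using R by blast
      moreover assume "\<epsilon> > 0"
      ultimately show "\<exists>m. \<exists>h\<in>K. h \<in> hom L (X m) (Y n) \<and> approx L \<epsilon> (h \<cdot> p m) (q n)"
        by (auto simp: factor_closure_def)
    qed
  qed
qed

text \<open>The identity of a limit object always lies in \<open>sigma_exists L K\<close>. Its
  membership in \<open>sigma_forall L K\<close>, read for two different sequences with that limit,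
  is the consistency condition.\<close>

lemma sigma_consistent_if_forall_eq_exists:
  assumes "sigma_forall L K = sigma_exists L K"
  shows "sigma_consistent L K"
  unfolding sigma_consistent_iff_factor_closure
proof (intro allI impI)
  fix X f Y g Z p q n assume s: "limit_seq X f Z p" and t: "limit_seq Y g Z q"
  then have Z: "Z \<in> limit_objs" by (auto simp: limit_objs_def)
  then have id: "Ident L Z \<in> hom L Z Z" using limit_objs_Obj ident_hom by blast
  have "Ident L Z \<in> sigma_forall L K" using ident_sigma_exists[OF Z] assms by simp
  then have "q n \<cdot> Ident L Z \<in> factor_closure X Z p (Y n)"
    using s t id unfolding mem_sigma_forall by (auto simp: hom_def)
  then show "q n \<in> factor_closure X Z p (Y n)" using ident_right[OF limit_seqD(3)[OF t]] by simp
qed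

end

section \<open>The consistent case\<close>

locale sigma_consistent_MU = MU_subcategory +
  assumes consistent: "sigma_consistent L K"
begin

lemma limit_map_consistent:
  "limit_seq X f Z p \<Longrightarrow> limit_seq Y g Z q \<Longrightarrow> q n \<in> factor_closure X Z p (Y n)"
  using consistent sigma_consistent_iff_factor_closure by blast

text \<open>Instance of \<open>factor_closure_comp\<close> with the identity of \<open>Z\<close> in
  place of \<open>h\<close>; the hypothesis on the legs then becomes consistency.\<close>

lemma factor_closure_indep:
  assumes s: "limit_seq X f Z p" and t: "limit_seq Y g Z q" and k: "k \<in> factor_closure Y Z q V"
  shows "k \<in> factor_closure X Z p V"
proof -
  have id: "Ident L Z \<in> hom L Z Z" using limit_seqD(3)[OF s] hom_obj(1) ident_hom by blast
  have "k \<cdot> Ident L Z \<in> factor_closure X Z p V"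
    using limit_map_consistent[OF s t] ident_right[OF limit_seqD(3)[OF t]]
    by (intro factor_closure_comp[OF s t id _ k]) simp
  moreover have "k \<in> hom L Z V" using k by (simp add: factor_closure_def)
  ultimately show ?thesis using ident_right by simp
qed

lemma sigma_forall_eq_exists: "sigma_forall L K = sigma_exists L K"
proof (rule subset_antisym[OF sigma_forall_subset_exists subsetI])
  fix h assume "h \<in> sigma_exists L K"
  then obtain X f p Y g q where h: "h \<in> Arr L" and s: "limit_seq X f (Dom L h) p"
    and t: "limit_seq Y g (Cod L h) q"
    and fc: "\<And>n. q n \<cdot> h \<in> factor_closure X (Dom L h) p (Y n)"
    unfolding mem_sigma_exists by blast
  have hh: "h \<in> hom L (Dom L h) (Cod L h)" using h by (simp add: hom_def)
  show "h \<in> sigma_forall L K"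
    unfolding mem_sigma_forall
  proof (intro conjI allI impI)
    show "h \<in> arrows_on_limits" using s t by (intro arrows_on_limitsI[OF hh]) (auto simp: limit_objs_def)
    fix X' f' p' Y' g' q' n
    assume s': "limit_seq X' f' (Dom L h) p'" and t': "limit_seq Y' g' (Cod L h) q'"
    \<comment> \<open>Consistency at the target places the new leg \<open>q' n\<close> in the
      closure along the old sequence \<open>Y\<close>. The source sequence is changed
      afterwards.\<close>
    have "q' n \<cdot> h \<in> factor_closure X (Dom L h) p (Y' n)"
      using factor_closure_comp[OF s t hh fc limit_map_consistent[OF t t']] .
    then show "q' n \<cdot> h \<in> factor_closure X' (Dom L h) p' (Y' n)"
      by (rule factor_closure_indep[OF s' s])
  qed
qed

text \<open>Since \<open>sigma_forall L K\<close> and \<open>sigma_exists L K\<close> coincide,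
  membership can be tested along whichever sequences are at hand.\<close>

lemma mem_sigma_exists_iff:
  assumes "limit_seq X f Z p" "limit_seq Y g W q" "h \<in> hom L Z W"
  shows "h \<in> sigma_exists L K \<longleftrightarrow> (\<forall>n. q n \<cdot> h \<in> factor_closure X Z p (Y n))"
proof
  assume "h \<in> sigma_exists L K"
  then show "\<forall>n. q n \<cdot> h \<in> factor_closure X Z p (Y n)"
    using assms unfolding sigma_forall_eq_exists[symmetric] mem_sigma_forall hom_def by blast
next
  assume "\<forall>n. q n \<cdot> h \<in> factor_closure X Z p (Y n)"
  then show "h \<in> sigma_exists L K"
    using assms unfolding mem_sigma_exists hom_def by blast
qed

text \<open>Represent the target by its constant sequence: every composite to be tested is then
  \<open>k\<close> itself.\<close>

lemma mem_sigma_exists_K_obj: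
  assumes s: "limit_seq X f Z p" and Y: "Y \<in> objs L K" and k: "k \<in> hom L Z Y"
  shows "k \<in> sigma_exists L K \<longleftrightarrow> k \<in> factor_closure X Z p Y"
  using mem_sigma_exists_iff[OF s limit_seq_const[OF Y] k] ident_left[OF k] by simp

section \<open>Limits of pre-transformations form a locally closed subcategory\<close>

lemma sigma_exists_on_limits: "sigma_exists L K \<subseteq> arrows_on_limits"
  unfolding sigma_forall_eq_exists[symmetric] using mem_sigma_forall by (intro subsetI) simp

lemma sigma_exists_Arr: "sigma_exists L K \<subseteq> Arr L"
  using sigma_exists_on_limits by (auto simp: arrows_on_limits_def maps_between_def)

lemma sigma_exists_limits:
  assumes "h \<in> sigma_exists L K"
  obtains X f p Y g q where "limit_seq X f (Dom L h) p" "limit_seq Y g (Cod L h) q"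
  using assms unfolding mem_sigma_exists by (elim conjE exE)

lemma subcategory_sigma_exists: "subcategory L (sigma_exists L K)"
  unfolding subcategory_def
proof (intro conjI ballI impI sigma_exists_Arr)
  fix h assume "h \<in> sigma_exists L K"
  then have "Dom L h \<in> limit_objs" "Cod L h \<in> limit_objs"
    using sigma_exists_on_limits by (auto simp: arrows_on_limits_def maps_between_def)
  then show "Ident L (Dom L h) \<in> sigma_exists L K" "Ident L (Cod L h) \<in> sigma_exists L K"
    using ident_sigma_exists by auto
next
  fix h k assume h: "h \<in> sigma_exists L K" and k: "k \<in> sigma_exists L K" and eq: "Cod L h = Dom L k"
  obtain X f p where s: "limit_seq X f (Dom L h) p" using sigma_exists_limits[OF h] by blast
  \<comment> \<open>One sequence at the middle object serves as target for \<open>h\<close> and as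
    source for \<open>k\<close>. Consistency is what permits this common choice.\<close>
  obtain Y g q V l r where t: "limit_seq Y g (Dom L k) q" and u: "limit_seq V l (Cod L k) r"
    using sigma_exists_limits[OF k] by blast
  have "h \<in> Arr L" "k \<in> Arr L" using h k sigma_exists_Arr by blast+
  then have hh: "h \<in> hom L (Dom L h) (Dom L k)" and kh: "k \<in> hom L (Dom L k) (Cod L k)"
    using eq by (simp_all add: hom_def)
  have "r n \<cdot> (k \<cdot> h) \<in> factor_closure X (Dom L h) p (V n)" for n
  proof -
    have "\<forall>n. q n \<cdot> h \<in> factor_closure X (Dom L h) p (Y n)"
      using mem_sigma_exists_iff[OF s t hh] h by (rule iffD1)
    moreover have "\<forall>n. r n \<cdot> k \<in> factor_closure Y (Dom L k) q (V n)"
      using mem_sigma_exists_iff[OF t u kh] k by (rule iffD1)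
    ultimately have "(r n \<cdot> k) \<cdot> h \<in> factor_closure X (Dom L h) p (V n)"
      using factor_closure_comp[OF s t hh] by blast
    then show ?thesis using comp_assoc[OF hh kh limit_seqD(3)[OF u]] by simp
  qed
  then show "k \<cdot> h \<in> sigma_exists L K"
    using mem_sigma_exists_iff[OF s u comp_hom[OF hh kh]] by blast
qed

text \<open>Composition with a leg \<open>q n\<close> is uniformly continuous, so approximants of
  \<open>h\<close> give approximants of \<open>q n \<cdot> h\<close> in a closed set.\<close>

lemma local_closure_sigma_exists: "local_closure L (sigma_exists L K) = sigma_exists L K"
proof (rule subset_antisym[OF subsetI subset_local_closure[OF sigma_exists_Arr]])
  fix h assume h: "h \<in> local_closure L (sigma_exists L K)"
  then have hh: "h \<in> hom L (Dom L h) (Cod L h)" by (simp add: hom_def local_closure_iff)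
  \<comment> \<open>Any one approximant shares its domain and codomain with \<open>h\<close>, and
    thereby supplies sequences for both.\<close>
  obtain h0 where h0: "h0 \<in> sigma_exists L K" "h0 \<in> hom L (Dom L h) (Cod L h)"
    using h by (rule local_closure_witness)
  have "Dom L h0 = Dom L h" "Cod L h0 = Cod L h" using h0(2) by (auto simp: hom_def)
  with sigma_exists_limits[OF h0(1)]
  obtain X f p Y g q where s: "limit_seq X f (Dom L h) p" and t: "limit_seq Y g (Cod L h) q"
    by metis
  have "q n \<cdot> h \<in> factor_closure X (Dom L h) p (Y n)" for n
  proof (rule factor_closure_closed[OF s comp_hom[OF hh limit_seqD(3)[OF t]]])
    fix \<epsilon> :: real assume "\<epsilon> > 0"
    then obtain \<delta> where \<delta>: "\<delta> > 0" "\<And>W g h'. g \<in> hom L W (Cod L h) \<Longrightarrow> h' \<in> hom L W (Cod L h) \<Longrightarrow>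
      approx L \<delta> g h' \<Longrightarrow> approx L \<epsilon> (q n \<cdot> g) (q n \<cdot> h')"
      using postcomp_delta[OF limit_seqD(3)[OF t]] by blast
    have "\<exists>h'\<in>sigma_exists L K \<inter> hom L (Dom L h) (Cod L h). approx L \<delta> h' h"
      using h \<delta>(1) by (simp add: local_closure_iff)
    then obtain h' where h': "h' \<in> sigma_exists L K" "h' \<in> hom L (Dom L h) (Cod L h)" "approx L \<delta> h' h"
      by blast
    have "approx L \<epsilon> (q n \<cdot> h') (q n \<cdot> h)" using \<delta>(2)[OF h'(2) hh h'(3)] .
    moreover have "q n \<cdot> h' \<in> factor_closure X (Dom L h) p (Y n)"
      using mem_sigma_exists_iff[OF s t h'(2)] h'(1) by blast
    ultimately show "\<exists>k'\<in>factor_closure X (Dom L h) p (Y n). approx L \<epsilon> k' (q n \<cdot> h)" by blast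
  qed
  then show "h \<in> sigma_exists L K" using mem_sigma_exists_iff[OF s t hh] by blast
qed

lemma cl_cat_sigma_exists: "cl_cat L (sigma_exists L K) = sigma_exists L K"
  by (rule subset_antisym[OF cl_cat_least[OF subcategory_sigma_exists order_refl] subset_cl_cat])

section \<open>Maps into objects of \<open>K\<close>\<close>

lemma K_factor_closure:
  assumes "k \<in> K" "k \<in> hom L X Y"
  shows "k \<in> factor_closure (\<lambda>_. X) X (\<lambda>_. Ident L X) Y"
proof -
  have "X \<in> objs L K" using K_obj[OF assms] by blast
  from factor_closure_K[OF limit_seq_const[OF this] assms] show ?thesis
    using ident_right[OF assms(2)] by simp
qed

lemma cl_lim_sigma_exists: "cl_lim L K K \<subseteq> sigma_exists L K"
proof
  fix k assume "k \<in> cl_lim L K K"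
  then consider "k \<in> K" | X f Z p n where "limit_seq X f Z p" "k = p n"
    by (auto simp: cl_lim_K)
  then show "k \<in> sigma_exists L K"
  proof cases
    case 1
    then have h: "k \<in> hom L (Dom L k) (Cod L k)" using K_Arr by (auto simp: hom_def)
    then have "Dom L k \<in> objs L K" "Cod L k \<in> objs L K" using K_obj[OF 1 h] by auto
    from mem_sigma_exists_K_obj[OF limit_seq_const[OF this(1)] this(2) h] K_factor_closure[OF 1 h]
    show ?thesis by (rule iffD2)
  next
    case 2
    from mem_sigma_exists_K_obj[OF 2(1) limit_seqD(5)[OF 2(1)] limit_seqD(3)[OF 2(1)]]
      limit_map_factor_closure[OF 2(1)]
    show ?thesis unfolding 2(2) by (rule iffD2)
  qed
qed

lemma local_closure_subset_sigma_exists: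
  "F \<subseteq> sigma_exists L K \<Longrightarrow> local_closure L F \<subseteq> sigma_exists L K"
  using local_closure_mono[of F "sigma_exists L K" L] by (simp add: local_closure_sigma_exists)

lemma sigma_start_sigma_exists: "sigma_start L K \<subseteq> sigma_exists L K"
  unfolding sigma_start_def
  by (intro local_closure_subset_sigma_exists cl_cat_least[OF subcategory_sigma_exists cl_lim_sigma_exists])

text \<open>Approximants have the codomain of the map they approximate, so this confines the local
  closure of \<open>cl_lim L K K\<close> to maps into objects of \<open>K\<close>.\<close>

lemma cod_cl_lim:
  assumes "k \<in> cl_lim L K K" shows "Cod L k \<in> objs L K"
proof -
  consider "k \<in> K" | X f Z p n where "limit_seq X f Z p" "k = p n"
    using assms by (auto simp: cl_lim_K)
  then show ?thesis
  proof cases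
    case 1
    then show ?thesis using subcategory_ident[OF subcategory_K] by blast
  next
    case 2
    have "Cod L k = X n" using limit_seqD(3)[OF 2(1)] 2(2) by (simp add: hom_def)
    then show ?thesis using limit_seqD(5)[OF 2(1)] by simp
  qed
qed

text \<open>By prepending \<open>e\<close>, each approximant \<open>e \<cdot> p m\<close> is a leg
  of another limit cone and hence belongs to \<open>cl_lim L K K\<close>; no composition closure
  intervenes.\<close>

lemma factor_closure_local_closure:
  assumes s: "limit_seq X f Z p" and k: "k \<in> factor_closure X Z p Y"
  shows "k \<in> local_closure L (cl_lim L K K)"
proof -
  have kh: "k \<in> hom L Z Y" using k by (simp add: factor_closure_def)
  have "\<exists>c\<in>cl_lim L K K \<inter> hom L Z Y. approx L \<epsilon> c k" if pos: "\<epsilon> > 0" for \<epsilon>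
  proof -
    obtain m e where e: "e \<in> K" "e \<in> hom L (X m) Y" "approx L \<epsilon> (e \<cdot> p m) k"
      using factor_closureE[OF k pos] .
    obtain X' f' p' where s': "limit_seq X' f' Z p'" and p': "p' 0 = e \<cdot> p m"
      using limit_seq_prepend[OF s e(1,2)] .
    have "e \<cdot> p m \<in> cl_lim L K K" using limit_map_cl_lim[OF s', of 0] p' by simp
    with e(3) comp_hom[OF limit_seqD(3)[OF s] e(2)] show ?thesis by blast
  qed
  with kh hom_obj[OF kh] show ?thesis unfolding local_closure_iff by (auto simp: hom_def)
qed

lemma local_closure_cl_lim:
  "local_closure L (cl_lim L K K) = sigma_exists L K \<inter> maps_between L limit_objs (objs L K)"
proof (intro equalityI subsetI)
  fix h assume h: "h \<in> local_closure L (cl_lim L K K)"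
  then have S: "h \<in> sigma_exists L K"
    using local_closure_subset_sigma_exists[OF cl_lim_sigma_exists] by blast
  obtain h0 where "h0 \<in> cl_lim L K K" "h0 \<in> hom L (Dom L h) (Cod L h)"
    using h by (rule local_closure_witness)
  then have "Cod L h \<in> objs L K" using cod_cl_lim[of h0] by (simp add: hom_def)
  with S sigma_exists_on_limits show "h \<in> sigma_exists L K \<inter> maps_between L limit_objs (objs L K)"
    by (auto simp: arrows_on_limits_def maps_between_def)
next
  fix h assume h: "h \<in> sigma_exists L K \<inter> maps_between L limit_objs (objs L K)"
  then obtain X f p where s: "limit_seq X f (Dom L h) p" by (auto simp: limit_objs_def maps_between_def)
  have "h \<in> hom L (Dom L h) (Cod L h)" "Cod L h \<in> objs L K"
    using h by (auto simp: maps_between_def hom_def)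
  then have "h \<in> factor_closure X (Dom L h) p (Cod L h)"
    using mem_sigma_exists_K_obj[OF s] h by blast
  then show "h \<in> local_closure L (cl_lim L K K)" by (rule factor_closure_local_closure[OF s])
qed

lemma local_closure_cl_lim_start: "local_closure L (cl_lim L K K) \<subseteq> sigma_start L K"
  unfolding sigma_start_def by (rule local_closure_mono[OF subset_cl_cat])

lemma local_closure_K:
  "local_closure L K = sigma_exists L K \<inter> maps_between L (objs L K) (objs L K)"
proof (intro equalityI subsetI)
  fix h assume h: "h \<in> local_closure L K"
  then have "h \<in> sigma_exists L K"
    using local_closure_subset_sigma_exists[OF order_trans[OF subset_cl_lim cl_lim_sigma_exists]] by blast
  moreover obtain h0 where "h0 \<in> K" "h0 \<in> hom L (Dom L h) (Cod L h)"
    using h by (rule local_closure_witness)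
  ultimately show "h \<in> sigma_exists L K \<inter> maps_between L (objs L K) (objs L K)"
    using K_obj sigma_exists_Arr by (auto simp: maps_between_def)
next
  fix h assume h: "h \<in> sigma_exists L K \<inter> maps_between L (objs L K) (objs L K)"
  then have X: "Dom L h \<in> objs L K" and Y: "Cod L h \<in> objs L K"
    and hh: "h \<in> hom L (Dom L h) (Cod L h)" by (auto simp: maps_between_def hom_def)
  have fc: "h \<in> factor_closure (\<lambda>_. Dom L h) (Dom L h) (\<lambda>_. Ident L (Dom L h)) (Cod L h)"
    using mem_sigma_exists_K_obj[OF limit_seq_const[OF X] Y hh] h by blast
  \<comment> \<open>Along the constant sequence at the source, the approximants
    \<open>e \<cdot> p m\<close> reduce to maps \<open>e\<close> in \<open>K\<close>.\<close>
  have "\<exists>f\<in>K \<inter> hom L (Dom L h) (Cod L h). approx L \<epsilon> f h" if pos: "\<epsilon> > 0" for \<epsilon>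
  proof -
    obtain e where e: "e \<in> K" "e \<in> hom L (Dom L h) (Cod L h)" "approx L \<epsilon> (e \<cdot> Ident L (Dom L h)) h"
      using factor_closureE[OF fc pos] .
    then show ?thesis using ident_right[OF e(2)] by auto
  qed
  with hh hom_obj[OF hh] show "h \<in> local_closure L K"
    unfolding local_closure_iff by (auto simp: hom_def)
qed

section \<open>Reflection and the collapse of the iteration\<close>

lemma cl_refl_subset_sigma_exists:
  assumes "F \<subseteq> sigma_exists L K"
  shows "cl_refl L K F \<subseteq> sigma_exists L K"
proof
  fix h assume h: "h \<in> cl_refl L K F"
  then consider "h \<in> F" | Y g q where "h \<in> Arr L" "limit_seq Y g (Cod L h) q" "\<And>n. q n \<cdot> h \<in> F"
    by (auto simp: cl_refl_def limit_seq_def)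
  then show "h \<in> sigma_exists L K"
  proof cases
    case 1
    then show ?thesis using assms by auto
  next
    case 2
    have hh: "h \<in> hom L (Dom L h) (Cod L h)" using 2 by (simp add: hom_def)
    have "h \<in> arrows_on_limits"
      using h cl_refl_on_limits[OF order_trans[OF assms sigma_exists_on_limits]] by blast
    then obtain X f p where s: "limit_seq X f (Dom L h) p"
      by (auto simp: arrows_on_limits_def maps_between_def limit_objs_def)
    \<comment> \<open>The reflection hypothesis only gives \<open>q n \<cdot> h \<in> F\<close>; as
      \<open>Y n\<close> is an object of \<open>K\<close>, this is already the closure
      condition.\<close>
    have "q n \<cdot> h \<in> factor_closure X (Dom L h) p (Y n)" for n
    proof -
      have "q n \<cdot> h \<in> sigma_exists L K" using 2(3) assms by blast
      with mem_sigma_exists_K_obj[OF s limit_seqD(5)[OF 2(2)] comp_hom[OF hh limit_seqD(3)[OF 2(2)]]]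
      show ?thesis by (rule iffD1)
    qed
    then show ?thesis using mem_sigma_exists_iff[OF s 2(2) hh] by simp
  qed
qed

text \<open>For \<open>h\<close> in \<open>sigma_exists L K\<close>, the legs \<open>q n\<close> and
  the composites \<open>q n \<cdot> h\<close> all lie in \<A>0, so a single reflection produces
  \<open>h\<close>.\<close>

lemma cl_refl_sigma_start: "cl_refl L K (sigma_start L K) = sigma_exists L K"
proof (rule subset_antisym[OF cl_refl_subset_sigma_exists[OF sigma_start_sigma_exists] subsetI])
  fix h assume h: "h \<in> sigma_exists L K"
  then obtain X f p Y g q where s: "limit_seq X f (Dom L h) p" and t: "limit_seq Y g (Cod L h) q"
    by (rule sigma_exists_limits)
  have hA: "h \<in> Arr L" and hh: "h \<in> hom L (Dom L h) (Cod L h)"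
    using h sigma_exists_Arr by (auto simp: hom_def)
  have "q n \<in> sigma_start L K" for n using limit_map_cl_lim[OF t] cl_lim_sigma_start by blast
  moreover have "q n \<cdot> h \<in> sigma_start L K" for n
  proof -
    have "q n \<cdot> h \<in> factor_closure X (Dom L h) p (Y n)"
      using mem_sigma_exists_iff[OF s t hh] h by simp
    from factor_closure_local_closure[OF s this] show ?thesis
      using local_closure_cl_lim_start by blast
  qed
  moreover have "bond L Y g i j \<in> K \<inter> sigma_start L K" if "i \<le> j" for i j
  proof -
    have "bond L Y g i j \<in> K" using bond_K(1)[OF _ that] t by (simp add: limit_seq_def)
    then show ?thesis using subset_cl_lim[of K L K] cl_lim_sigma_start by blast
  qed
  moreover have "K_sequence L K Y g" "is_limit L Y g (Cod L h) q" using t by (auto simp: limit_seq_def)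
  ultimately show "h \<in> cl_refl L K (sigma_start L K)"
    unfolding cl_refl_def using hA
    by (intro UnI2 CollectI conjI exI[of _ Y] exI[of _ g] exI[of _ "Cod L h"] exI[of _ q]) auto
qed

lemma sigma_step_start: "sigma_step L K (sigma_start L K) = sigma_exists L K"
  by (simp add: sigma_step_def cl_refl_sigma_start cl_cat_sigma_exists local_closure_sigma_exists)

lemma sigma_step_sigma_exists: "sigma_step L K (sigma_exists L K) = sigma_exists L K"
proof -
  have "cl_refl L K (sigma_exists L K) = sigma_exists L K"
    by (rule subset_antisym[OF cl_refl_subset_sigma_exists[OF order_refl] subset_cl_refl])
  then show ?thesis
    by (simp add: sigma_step_def cl_cat_sigma_exists local_closure_sigma_exists)
qed

text \<open>One step leads from \<open>sigma_start L K\<close> to \<open>sigma_exists L K\<close>,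
  which is a fixed point of the step; a union at a limit index therefore cannot exceed it.\<close>

lemma sigma_stage_stable:
  assumes r: "Well_order r"
  shows "sigma_stage L K r a = (if underS r a = {} then sigma_start L K else sigma_exists L K)"
  using r
proof (induction a rule: sigma_stage_induct)
  case (succ a b)
  then have "underS r a \<noteq> {}" by (auto simp: immediate_pred_def)
  then show ?case using succ sigma_step_start sigma_step_sigma_exists by simp
next
  case (limit a)
  \<comment> \<open>Otherwise every predecessor of \<open>a\<close> would be least in
    \<open>r\<close>, and by totality such a \<open>b\<close> would be an immediate predecessor. A
    nonzero predecessor ensures that the union attains \<open>sigma_exists L K\<close>.\<close>
  have "\<exists>b\<in>underS r a. underS r b \<noteq> {}"
  proof (rule ccontr)
    assume *: "\<not> ?thesis"
    obtain b where b: "b \<in> underS r a" using limit by blast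
    have "(c, b) \<in> r" if "c \<in> underS r a" for c
    proof -
      have "b \<in> Field r" "c \<in> Field r" "b \<notin> underS r c"
        using b that * by (auto simp: underS_def Field_def)
      moreover have "(b, c) \<in> r \<or> (c, b) \<in> r"
        using calculation wo_rel.TOTALS[of r] r unfolding wo_rel_def by blast
      ultimately show ?thesis by (auto simp: underS_def)
    qed
    with b limit(2) show False by (auto simp: immediate_pred_def)
  qed
  then obtain b where b: "b \<in> underS r a" "underS r b \<noteq> {}" by blast
  have "sigma_stage L K r c \<subseteq> sigma_exists L K" if "c \<in> underS r a" for c
    using limit(3)[OF that] sigma_start_sigma_exists by simp
  moreover have "sigma_stage L K r b = sigma_exists L K"
    using limit(3)[OF b(1)] b(2) by simp
  ultimately have "(\<Union>b\<in>underS r a. sigma_stage L K r b) = sigma_exists L K"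
    using b(1) by blast
  then show ?case using limit(1) by simp
qed simp

lemma sigma_closure_eq: "sigma_closure L K = sigma_exists L K"
proof
  show "sigma_closure L K \<subseteq> sigma_exists L K"
    using sigma_start_sigma_exists
    by (auto simp: sigma_closure_def sigma_stage_stable[OF Well_order_omega1] split: if_splits)
  show "sigma_exists L K \<subseteq> sigma_closure L K"
  proof -
    obtain a where a: "a \<in> Field omega1" "underS omega1 a \<noteq> {}" using underS_nonzero_ex by blast
    then have "sigma_stage L K omega1 a = sigma_exists L K"
      using sigma_stage_stable[OF Well_order_omega1, of a] by simp
    with a(1) show ?thesis unfolding sigma_closure_def by blast
  qed
qed

lemma locally_dense_sigma_exists: "locally_dense L K (sigma_exists L K)"
  unfolding locally_dense_def
proof (intro ballI subset_antisym)
  fix X Y assume XY: "X \<in> objs L K" "Y \<in> objs L K"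
  show "metric_closure L (sigma_exists L K \<inter> hom L X Y) (K \<inter> hom L X Y) \<subseteq> sigma_exists L K \<inter> hom L X Y"
    by (auto simp: metric_closure_def)
  show "sigma_exists L K \<inter> hom L X Y \<subseteq> metric_closure L (sigma_exists L K \<inter> hom L X Y) (K \<inter> hom L X Y)"
  proof
    fix h assume h: "h \<in> sigma_exists L K \<inter> hom L X Y"
    then have "h \<in> local_closure L K" using XY by (auto simp: local_closure_K maps_between_def hom_def)
    with h show "h \<in> metric_closure L (sigma_exists L K \<inter> hom L X Y) (K \<inter> hom L X Y)"
      by (auto simp: local_closure_iff metric_closure_def hom_def)
  qed
qed

end

text \<open>The last clause ranges over arbitrary well-orders on a type, so that stabilization at
  \<A>1 is expressed for more indices than the countable ordinals in \<open>omega1\<close>.\<close>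

theorem propositionA11:
  fixes L :: "('o, 'a) mucat" and K :: "'a set"
  assumes "MU_category L" and "subcategory L K"
  shows "(sigma_consistent L K \<longleftrightarrow> sigma_forall L K = sigma_exists L K)
    \<and> (sigma_consistent L K \<longrightarrow>
        sigma_closure L K \<inter> maps_between L (objs L K) (objs L K) = local_closure L K
      \<and> locally_dense L K (sigma_closure L K)
      \<and> sigma_closure L K \<inter> maps_between L (objs L (sigma_closure L K)) (objs L K)
          = local_closure L (cl_lim L K K)
      \<and> local_closure L (cl_lim L K K)
          = sigma_start L K \<inter> maps_between L (objs L (sigma_closure L K)) (objs L K)
      \<and> sigma_closure L K = sigma_forall L K
      \<and> sigma_forall L K = sigma_exists L K
      \<and> sigma_exists L K = cl_refl L K (sigma_start L K)
      \<and> cl_refl L K (sigma_start L K) = sigma_step L K (sigma_start L K)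
      \<and> (\<forall>(r :: 'i rel) a. Well_order r \<and> a \<in> Field r \<and> underS r a \<noteq> {} \<longrightarrow>
            sigma_stage L K r a = sigma_step L K (sigma_start L K)))"
proof (intro conjI impI)
  interpret MU_subcategory L K
    using assms by (simp add: MU_subcategory_def MU_subcategory_axioms_def)
  show "sigma_consistent L K \<longleftrightarrow> sigma_forall L K = sigma_exists L K"
    using sigma_consistent_if_forall_eq_exists
      sigma_consistent_MU.sigma_forall_eq_exists[OF sigma_consistent_MU.intro[OF MU_subcategory_axioms]]
    by (auto simp: sigma_consistent_MU_axioms_def)
next
  assume "sigma_consistent L K"
  then interpret sigma_consistent_MU L K
    using assms
    by (simp add: sigma_consistent_MU_def sigma_consistent_MU_axioms_def
        MU_subcategory_def MU_subcategory_axioms_def)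
  note eqs = sigma_closure_eq objs_sigma_closure[unfolded sigma_closure_eq]
  show "sigma_closure L K \<inter> maps_between L (objs L K) (objs L K) = local_closure L K"
    by (simp add: eqs local_closure_K)
  show "locally_dense L K (sigma_closure L K)"
    by (simp add: eqs locally_dense_sigma_exists)
  show "sigma_closure L K \<inter> maps_between L (objs L (sigma_closure L K)) (objs L K)
      = local_closure L (cl_lim L K K)"
    by (simp add: eqs local_closure_cl_lim)
  show "local_closure L (cl_lim L K K)
      = sigma_start L K \<inter> maps_between L (objs L (sigma_closure L K)) (objs L K)"
    using local_closure_cl_lim_start sigma_start_sigma_exists by (auto simp: eqs local_closure_cl_lim)
  show "sigma_closure L K = sigma_forall L K"
    by (simp add: eqs sigma_forall_eq_exists)
  show "sigma_forall L K = sigma_exists L K"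
    by (rule sigma_forall_eq_exists)
  show "sigma_exists L K = cl_refl L K (sigma_start L K)"
    by (simp add: cl_refl_sigma_start)
  show "cl_refl L K (sigma_start L K) = sigma_step L K (sigma_start L K)"
    by (simp add: cl_refl_sigma_start sigma_step_start)
  show "\<forall>(r :: 'i rel) a. Well_order r \<and> a \<in> Field r \<and> underS r a \<noteq> {} \<longrightarrow>
      sigma_stage L K r a = sigma_step L K (sigma_start L K)"
    by (simp add: sigma_stage_stable sigma_step_start)
qed

end
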